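(* Let $q\in\mathbb{R}[x]$ be a monic quartic polynomial which is indefinite and has no multiple roots, and let $C$ be the affine curve $y^2+q(x)=0$ over $\mathbb{R}$. There is an integer $N\ge1$ such that $$\theta(f)\le N+\Bigl\lceil\tfrac12\delta(f)\Bigr\rceil$$ holds for every psd $f\in\mathbb{R}[C]$.
   Context: $\mathbb{R}[C]=\mathbb{R}[x,y]/(y^2+q(x))$. Indefinite means $q$ takes both positive and negative values on $\mathbb{R}$. The nonsingular projective model of $C$ has exactly two points at infinity, a complex conjugate pair $\infty,\overline\infty$. For $f\in\mathbb{R}(C)^*$ put $\delta(f)=-v_\infty(f)$ ($v_\infty$ the discrete valuation at $\infty$), $\delta(0)=-\infty$; for $f=a(x)+b(x)y$ with $a,b\in\mathbb{R}[x]$, $\delta(f)=\max\{\deg a,\deg b+2\}$. An element $f\in\mathbb{R}[C]$ is psd if $f(p)\ge0$ for all $p\in C(\mathbb{R})$. For $0\ne f\in\mathbb{R}[C]$, $\theta(f)$ is the least integer $d\ge0$ such that $f=f_1^2+\cdots+f_r^2$ for some $r\in\mathbb{N}$ and $f_i\in\mathbb{R}[C]$ with $\delta(f_i)\le d$ for all $i$; $\theta(f)=\infty$ if no such representation exists. *)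

theory Defs
  imports Complex_Main "HOL-Computational_Algebra.Polynomial" "HOL-Library.Extended_Real"
    "HOL-Library.Extended_Nat"
begin

text \<open>Elements of R[C] = R[x,y]/(y^2+q(x)) are written uniquely as a(x)+b(x)y,
  represented by the pair (a,b) of real polynomials.\<close>

type_synonym crv = "real poly \<times> real poly"

definition deg_m :: "real poly \<Rightarrow> ereal" where
  "deg_m p = (if p = 0 then -\<infinity> else ereal (real (degree p)))"

definition delta :: "crv \<Rightarrow> ereal" where
  "delta f = max (deg_m (fst f)) (deg_m (snd f) + 2)"

text \<open>Square of a + b y in R[C]: (a+by)^2 = a^2 - q b^2 + 2ab y.\<close>
definition csq :: "real poly \<Rightarrow> crv \<Rightarrow> crv" where
  "csq q g = ((fst g)^2 - q * (snd g)^2, 2 * fst g * snd g)"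

definition csum_sq :: "real poly \<Rightarrow> crv list \<Rightarrow> crv" where
  "csum_sq q gs = (sum_list (map (\<lambda>g. fst (csq q g)) gs), sum_list (map (\<lambda>g. snd (csq q g)) gs))"

definition psd_on_curve :: "real poly \<Rightarrow> crv \<Rightarrow> bool" where
  "psd_on_curve q f \<longleftrightarrow>
     (\<forall>x y::real. y^2 + poly q x = 0 \<longrightarrow> poly (fst f) x + poly (snd f) x * y \<ge> 0)"

definition sos_deg :: "real poly \<Rightarrow> crv \<Rightarrow> nat \<Rightarrow> bool" where
  "sos_deg q f d \<longleftrightarrow> (\<exists>gs. f = csum_sq q gs \<and> (\<forall>g\<in>set gs. delta g \<le> ereal (real d)))"

definition theta :: "real poly \<Rightarrow> crv \<Rightarrow> enat" where
  "theta q f = (if \<exists>d. sos_deg q f d then enat (LEAST d. sos_deg q f d) else \<infinity>)"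

end

theory Submission
  imports Defs
    "HOL-Computational_Algebra.Fundamental_Theorem_Algebra"
    "HOL-Computational_Algebra.Polynomial_Factorial"
    "HOL-Computational_Algebra.Field_as_Ring"
begin

text \<open>
  Let $f = a + b y$ be positive on $C(\mathbb{R})$, of odd degree $\delta(f) = 2k - 1$. The norm
  $a^2 + q b^2$ is a positive polynomial $H \overline{H}$, and linear algebra yields
  $h = \alpha + \beta y$ over $\mathbb{C}$ with $\delta(h) \<le> k$ which vanishes on the half of the
  zeros of $f$ given by $H$. Then $h \overline{h} = f g$ where $g$ is a polynomial in $x$ of degree at
  most one, nonnegative wherever $q \<le> 0$. Such $g$ form the cone generated by $x - r_1$ and
  $r_4 - x$ for the extreme real roots $r_1 < r_4$ of $q$, so they are sums of squares of uniformly
  bounded degree; rotating such a representation of $g$ makes $h \overline{h} / g$ a sum of squares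
  again. A general psd $f$ is a limit of elements of this kind, and sums of six squares of bounded
  degree form a closed set.
\<close>

section \<open>Real and complex polynomials\<close>

text \<open>A zero count explains the shape. If delta(f) = 2k - 1, then f has a pole of that order
  at both points at infinity, hence 2(2k - 1) zeros, and half of them is 2k - 1. The elements h with
  delta(h) \<le> k form a space of dimension 2k, so 2k - 1 zeros can be prescribed. Such an h may
  have 2k zeros, and the last one cannot be chosen: the curve has genus one, where a given half of
  the zeros need not be cut out by a function. The factor g is the trace of this spare zero. Odd
  delta(f) leaves just one zero to spare, and this keeps g linear and free of y. The bound is
  uniform because the admissible g form a cone with two generators that depend on q alone, so one
  certificate degree serves every f. The limit argument also needs a number of squares that is the
  same for all approximants: three Hermitian squares, each the sum of two real ones, account for the
  six.\<close>

abbreviation cpoly :: "real poly \<Rightarrow> complex poly" where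
  "cpoly \<equiv> map_poly complex_of_real"

abbreviation cnjp :: "complex poly \<Rightarrow> complex poly" where
  "cnjp \<equiv> map_poly cnj"

lemma poly_map_poly_Re: "poly (map_poly Re H) x = Re (poly H (complex_of_real x))"
  by (induction H) (auto simp: map_poly_pCons)

lemma poly_map_poly_Im: "poly (map_poly Im H) x = Im (poly H (complex_of_real x))"
  by (induction H) (auto simp: map_poly_pCons)

lemma poly_cpoly_of_real: "poly (cpoly p) (complex_of_real x) = complex_of_real (poly p x)"
  by (induction p) (auto simp: map_poly_pCons)

lemma poly_cnjp: "poly (cnjp H) z = cnj (poly H (cnj z))"
  by (induction H) (auto simp: map_poly_pCons)

lemma cpoly_mult: "cpoly (p * r) = cpoly p * cpoly r"
  by (rule poly_eqI) (simp add: coeff_map_poly coeff_mult)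

lemma cpoly_add: "cpoly (p + r) = cpoly p + cpoly r"
  by (rule poly_eqI) (simp add: coeff_map_poly)

lemma cpoly_diff: "cpoly (p - r) = cpoly p - cpoly r"
  by (rule poly_eqI) (simp add: coeff_map_poly)

lemma cpoly_smult: "cpoly (smult c p) = smult (of_real c) (cpoly p)"
  by (rule poly_eqI) (simp add: coeff_map_poly)

lemma cnjp_mult: "cnjp (p * r) = cnjp p * cnjp r"
  by (rule poly_eqI) (simp add: coeff_map_poly coeff_mult)

lemma cnjp_cpoly: "cnjp (cpoly p) = cpoly p"
  by (rule poly_eqI) (simp add: coeff_map_poly)

lemma degree_cpoly: "degree (cpoly p) = degree p"
  by (rule degree_map_poly) auto

lemma degree_map_poly_Re_le: "degree (map_poly Re H) \<le> degree H"
  and degree_map_poly_Im_le: "degree (map_poly Im H) \<le> degree H"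
  by (auto intro!: degree_le simp: coeff_map_poly coeff_eq_0)

text \<open>Real division with remainder remains one over the complex numbers and degrees are
  preserved, so a nonzero remainder would be a multiple of \<open>cpoly p\<close> of too small a
  degree.\<close>

lemma cpoly_dvd_cpoly_iff: "cpoly p dvd cpoly r \<longleftrightarrow> p dvd r"
proof
  assume "p dvd r"
  then show "cpoly p dvd cpoly r"
    by (metis cpoly_mult dvd_def)
next
  assume *: "cpoly p dvd cpoly r"
  show "p dvd r"
  proof (cases "p = 0")
    case True
    then have "cpoly r = 0" using * by simp
    then have "r = 0"
      by (metis degree_cpoly leading_coeff_0_iff coeff_map_poly of_real_0 of_real_eq_0_iff)
    then show ?thesis by simp
  next
    case False
    have "r = p * (r div p) + r mod p" by simp
    then have "cpoly r = cpoly p * cpoly (r div p) + cpoly (r mod p)"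
      by (metis cpoly_add cpoly_mult)
    then have d: "cpoly p dvd cpoly (r mod p)"
      using * by (metis dvd_add_right_iff dvd_triv_left)
    show ?thesis
    proof (rule ccontr)
      assume "\<not> p dvd r"
      then have nz: "r mod p \<noteq> 0" by (simp add: dvd_eq_mod_eq_0)
      then have "cpoly (r mod p) \<noteq> 0"
        by (metis degree_cpoly leading_coeff_0_iff coeff_map_poly of_real_0 of_real_eq_0_iff)
      then have "degree p \<le> degree (r mod p)"
        using dvd_imp_degree_le[OF d] by (simp add: degree_cpoly)
      with degree_mod_less[OF False, of r] nz show False by simp
    qed
  qed
qed

section \<open>Nonnegative real polynomials as Hermitian squares\<close>

lemma poly_nonneg_from_punctured:
  fixes p :: "real poly"
  assumes "\<And>x. x \<noteq> r \<Longrightarrow> poly p x \<ge> 0"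
  shows "poly p x \<ge> 0"
proof (cases "x = r")
  case True
  have "(poly p \<longlongrightarrow> poly p r) (at r)"
    by (rule isContD[unfolded isCont_def]) (simp add: isCont_def[symmetric])
  moreover have "eventually (\<lambda>x. poly p x \<ge> 0) (at r)"
    by (simp add: assms eventually_at_filter)
  ultimately show ?thesis
    using True tendsto_lowerbound[of "poly p" "poly p r" "at r" 0] by simp
qed (use assms in auto)

lemma poly_eq_from_infinite:
  fixes p r :: "'a::idom poly"
  assumes "infinite {x. poly p x = poly r x}"
  shows "p = r"
proof (rule ccontr)
  assume "p \<noteq> r"
  then have "finite {x. poly (p - r) x = 0}" by (intro poly_roots_finite) simp
  with assms show False by simp
qed

lemma poly_eq_from_punctured:
  fixes p r :: "real poly"
  assumes "\<And>x. x \<noteq> x0 \<Longrightarrow> poly p x = poly r x"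
  shows "p = r"
proof (rule poly_eq_from_infinite)
  have "UNIV - {x0} \<subseteq> {x. poly p x = poly r x}" using assms by auto
  moreover have "infinite (UNIV - {x0})" by (simp add: infinite_UNIV_char_0)
  ultimately show "infinite {x. poly p x = poly r x}" using infinite_super by blast
qed

text \<open>After one factor x - r is removed, the cofactor is \<ge> 0 to the right of r and \<le> 0
  to the left, so continuity makes it vanish at r once more.\<close>

lemma nonneg_poly_root_double:
  fixes p :: "real poly"
  assumes nn: "\<And>x. poly p x \<ge> 0" and "poly p r = 0"
  obtains p' where "p = [:-r, 1:]\<^sup>2 * p'" "\<And>x. poly p' x \<ge> 0"
proof -
  obtain p1 where p1: "p = [:-r, 1:] * p1"
    using assms(2) poly_eq_0_iff_dvd by (metis dvdE)
  have pt: "poly p x = (x - r) * poly p1 x" for x by (simp add: p1 algebra_simps)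
  have "poly p1 r = 0"
  proof (rule antisym)
    have *: "(poly p1 \<longlongrightarrow> poly p1 r) (at r)"
      by (rule isContD[unfolded isCont_def]) (simp add: isCont_def[symmetric])
    then have r: "(poly p1 \<longlongrightarrow> poly p1 r) (at_right r)" and l: "(poly p1 \<longlongrightarrow> poly p1 r) (at_left r)"
      by (auto simp: filterlim_at_split)
    have "poly p1 x \<ge> 0" if "x > r" for x
      using nn[of x] that by (simp add: pt zero_le_mult_iff)
    then have "eventually (\<lambda>x. poly p1 x \<ge> 0) (at_right r)"
      by (simp add: eventually_at_filter)
    with r show "poly p1 r \<ge> 0"
      using tendsto_lowerbound[of "poly p1" "poly p1 r" "at_right r" 0] by simp
    have "poly p1 x \<le> 0" if "x < r" for x
      using nn[of x] that by (simp add: pt zero_le_mult_iff)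
    then have "eventually (\<lambda>x. poly p1 x \<le> 0) (at_left r)"
      by (simp add: eventually_at_filter)
    with l show "poly p1 r \<le> 0"
      using tendsto_upperbound[of "poly p1" "poly p1 r" "at_left r" 0] by simp
  qed
  then obtain p2 where p2: "p1 = [:-r, 1:] * p2"
    using poly_eq_0_iff_dvd by (metis dvdE)
  have e: "p = [:-r, 1:]\<^sup>2 * p2" unfolding p1 p2 power2_eq_square by (simp only: mult.assoc)
  have "poly p2 x \<ge> 0" for x
  proof (rule poly_nonneg_from_punctured)
    fix x assume "x \<noteq> r"
    then have "(x - r)\<^sup>2 > 0" by simp
    moreover have "poly p x = (x - r)\<^sup>2 * poly p2 x" by (simp add: e)
    ultimately show "poly p2 x \<ge> 0" using nn[of x] by (simp add: zero_le_mult_iff)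
  qed
  with e that show thesis by blast
qed

text \<open>Induction strips off a double real root, one copy going to \<open>H\<close> and one to
  its conjugate, or a pair w, cnj w, of which \<open>H\<close> receives the member in the upper half
  plane. This choice of half planes is what later makes \<open>H\<close> and \<open>cnjp H\<close>
  coprime when p has no real root.\<close>

lemma nonneg_poly_hermitian_square:
  fixes p :: "real poly"
  assumes "p \<noteq> 0" and "\<And>x. poly p x \<ge> 0"
  shows "\<exists>H. cpoly p = H * cnjp H \<and> (\<forall>z. poly H z = 0 \<longrightarrow> Im z \<ge> 0) \<and> 2 * degree H = degree p"
  using assms
proof (induction "degree p" arbitrary: p rule: less_induct)
  case less
  show ?case
  proof (cases "degree p = 0")
    case True
    then obtain c where c: "p = [:c:]" by (metis degree_eq_zeroE)
    with less.prems have "c > 0" by (metis linorder_not_less order_antisym pCons_0_0 poly_const_conv)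
    then show ?thesis
      by (intro exI[of _ "[:complex_of_real (sqrt c):]"])
         (auto simp: c map_poly_pCons simp flip: of_real_mult)
  next
    case False
    then have "degree (cpoly p) \<noteq> 0" by (simp add: degree_cpoly)
    then have "\<not> constant (poly (cpoly p))" by (simp add: constant_degree)
    then obtain z where z: "poly (cpoly p) z = 0"
      using fundamental_theorem_of_algebra by blast
    show ?thesis
    proof (cases "Im z = 0")
      case True
      then have "z = complex_of_real (Re z)" by (simp add: complex_eq_iff)
      then have "poly p (Re z) = 0" using z by (metis of_real_eq_0_iff poly_cpoly_of_real)
      then obtain p' where p': "p = [:-Re z, 1:]\<^sup>2 * p'" "\<And>x. poly p' x \<ge> 0"
        using nonneg_poly_root_double[of p "Re z"] less.prems by blast
      then have nz: "p' \<noteq> 0" using less.prems by auto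
      have dp: "degree p = degree p' + 2"
        using nz by (simp add: p'(1) degree_mult_eq degree_power_eq)
      then obtain H where H: "cpoly p' = H * cnjp H" "\<forall>z. poly H z = 0 \<longrightarrow> Im z \<ge> 0" "2 * degree H = degree p'"
        using less.hyps[of p'] nz p'(2) by auto
      \<comment> \<open>The zero polynomial would vanish at -i, which lies below the real
        axis.\<close>
      have "H \<noteq> 0" using H(2)[rule_format, of "-\<i>"] by auto
      have e: "cpoly [:- Re z, 1:] = [:- z, 1:]" "cnjp [:-z,1:] = [:-z,1:]"
        using True by (auto simp: map_poly_pCons complex_eq_iff)
      show ?thesis
        using H \<open>H \<noteq> 0\<close> True
        by (intro exI[of _ "[:-z,1:] * H"])
          (auto simp: p'(1) cpoly_mult cnjp_mult e power2_eq_square dp[unfolded p'(1) power2_eq_square]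
            degree_mult_eq simp del: mult_pCons_left mult_pCons_right)
    next
      case False
      have "poly (cpoly p) (cnj z) = 0"
        using z by (metis cnjp_cpoly complex_cnj_cnj complex_cnj_zero poly_cnjp)
      then obtain w where w: "poly (cpoly p) w = 0" "Im w > 0"
        using z False that[of z] that[of "cnj z"] by (cases "Im z > 0") auto
      define m where "m = [:(cmod w)\<^sup>2, -2 * Re w, 1:]"
      have cm: "cpoly m = [:-w, 1:] * [:-cnj w, 1:]"
        by (simp add: m_def map_poly_pCons complex_mult_cnj cmod_power2 complex_eq_iff)
           (simp add: power2_eq_square)
      have dm: "degree m = 2" by (simp add: m_def)
      then have mnz: "m \<noteq> 0" by auto
      have "p = m * (p div m) + p mod m" by simp
      then have "cpoly p = cpoly m * cpoly (p div m) + cpoly (p mod m)"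
        by (metis cpoly_add cpoly_mult)
      then have r0: "poly (cpoly (p mod m)) w = 0"
        using w(1) by (simp add: cm del: mult_pCons_left mult_pCons_right)
      \<comment> \<open>The remainder is real of degree at most one and vanishes at the nonreal w,
        so it is zero.\<close>
      have "degree (p mod m) < 2"
        using degree_mod_less[OF mnz, of p] dm by auto
      then have "p mod m = [:coeff (p mod m) 0, coeff (p mod m) 1:]"
        by (intro poly_eqI) (auto simp: coeff_pCons coeff_eq_0 split: nat.splits)
      then obtain u v where uv: "p mod m = [:u, v:]" by blast
      have "complex_of_real u + w * complex_of_real v = 0" using r0 by (simp add: uv map_poly_pCons)
      then have "v = 0" "u = 0" using w(2) by (auto simp: complex_eq_iff)
      then have "m dvd p" using uv by (simp add: dvd_eq_mod_eq_0)
      then obtain p' where p': "p = m * p'" by (metis dvdE)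
      then have nz: "p' \<noteq> 0" using less.prems by auto
      have mpos: "poly m x > 0" for x
      proof -
        have "poly m x = (x - Re w)\<^sup>2 + (Im w)\<^sup>2"
          by (simp add: m_def cmod_power2) (simp add: power2_eq_square algebra_simps)
        then show ?thesis using w(2) by (simp add: add_nonneg_pos)
      qed
      have pos: "poly p' x \<ge> 0" for x
        using less.prems(2)[of x] mpos[of x] by (simp add: p' zero_le_mult_iff)
      have dp: "degree p = degree p' + 2" using nz mnz dm by (simp add: p' degree_mult_eq)
      then obtain H where H: "cpoly p' = H * cnjp H" "\<forall>z. poly H z = 0 \<longrightarrow> Im z \<ge> 0" "2 * degree H = degree p'"
        using less.hyps[of p'] nz pos by auto
      have "H \<noteq> 0" using H(2)[rule_format, of "-\<i>"] by auto
      have e: "cnjp [:-w,1:] = [:-cnj w,1:]" by (simp add: map_poly_pCons)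
      show ?thesis
        using H \<open>H \<noteq> 0\<close> w(2)
        by (intro exI[of _ "[:-w,1:] * H"])
          (auto simp: p' cpoly_mult cnjp_mult e cm dp[unfolded p'] degree_mult_eq simp del: mult_pCons_left mult_pCons_right)
    qed
  qed
qed

lemma nonneg_poly_two_squares:
  fixes p :: "real poly"
  assumes "\<And>x. poly p x \<ge> 0"
  obtains u v where "p = u\<^sup>2 + v\<^sup>2" "2 * degree u \<le> degree p" "2 * degree v \<le> degree p"
proof (cases "p = 0")
  case True
  then show ?thesis using that[of 0 0] by simp
next
  case False
  then obtain H where H: "cpoly p = H * cnjp H" "2 * degree H = degree p"
    using nonneg_poly_hermitian_square[of p] assms by blast
  have "poly p x = (poly (map_poly Re H) x)\<^sup>2 + (poly (map_poly Im H) x)\<^sup>2" for x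
  proof -
    have "complex_of_real (poly p x) = poly H (of_real x) * cnj (poly H (of_real x))"
      by (metis H(1) complex_cnj_complex_of_real poly_cnjp poly_cpoly_of_real poly_mult)
    then show ?thesis
      by (simp add: poly_map_poly_Re poly_map_poly_Im complex_mult_cnj complex_eq_iff)
  qed
  then have "p = (map_poly Re H)\<^sup>2 + (map_poly Im H)\<^sup>2"
    by (intro poly_eq_from_punctured) (auto)
  then show ?thesis
    using that[of "map_poly Re H" "map_poly Im H"] H(2)
      degree_map_poly_Re_le[of H] degree_map_poly_Im_le[of H] by simp
qed

section \<open>Half of the zeros of a positive element\<close>

text \<open>Each root of \<open>H\<close> imposes one linear condition on the coefficients, and
  there are more unknowns than conditions. Multiplicities need no derivatives, because the roots are
  divided out one at a time: if all \<open>F j\<close> vanish at z, the factor is cancelled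
  directly; otherwise a pivot \<open>F p\<close> is used to make the others vanish at z, at the
  price of one unknown.\<close>

lemma poly_combination_dvd:
  fixes H :: "complex poly" and F :: "nat \<Rightarrow> complex poly"
  assumes "H \<noteq> 0" and "degree H < m"
  shows "\<exists>v. (\<exists>j<m. v j \<noteq> 0) \<and> H dvd (\<Sum>j<m. smult (v j) (F j))"
  using assms
proof (induction "degree H" arbitrary: H F m)
  case 0
  then have "H dvd 1" by (metis is_unit_iff_degree)
  then have "H dvd p" for p by (metis dvd_trans one_dvd)
  with 0 show ?case by (intro exI[of _ "\<lambda>_. 1"]) auto
next
  case (Suc n)
  from Suc.hyps(2) have "\<not> constant (poly H)" by (metis constant_degree nat.distinct(1))
  then obtain z where "poly H z = 0" using fundamental_theorem_of_algebra by blast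
  then obtain H' where H': "H = [:-z, 1:] * H'" by (metis dvdE poly_eq_0_iff_dvd)
  with Suc.prems(1) have nz: "H' \<noteq> 0" by (metis mult_zero_right)
  then have "degree H = Suc (degree H')" unfolding H' by (subst degree_mult_eq) simp_all
  with Suc.hyps(2) have dH': "degree H' = n" by linarith
  from Suc.prems obtain m' where m: "m = Suc m'" by (cases m) auto
  then have m': "degree H' < m'" using dH' Suc.hyps(2) Suc.prems(2) by linarith
  show ?case
  proof (cases "\<forall>j<m. poly (F j) z = 0")
    case True
    then have "\<forall>j<m. \<exists>G. F j = [:-z, 1:] * G" unfolding poly_eq_0_iff_dvd dvd_def .
    then obtain G where G: "\<And>j. j < m \<Longrightarrow> F j = [:-z, 1:] * G j"
      unfolding choice_iff' by blast
    have "degree H' < m" using m' m by simp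
    from Suc.hyps(1)[OF dH'[symmetric] nz this, of G]
    obtain v where v: "\<exists>j<m. v j \<noteq> 0" "H' dvd (\<Sum>j<m. smult (v j) (G j))"
      by blast
    have "(\<Sum>j<m. smult (v j) (F j)) = [:-z, 1:] * (\<Sum>j<m. smult (v j) (G j))"
      unfolding sum_distrib_left by (intro sum.cong refl) (simp add: G del: mult_pCons_left)
    then have "H dvd (\<Sum>j<m. smult (v j) (F j))"
      using v(2) H' mult_dvd_mono[OF dvd_refl] by metis
    with v(1) show ?thesis by blast
  next
    case False
    then obtain p where p: "p < m" "poly (F p) z \<noteq> 0" by auto
    define s where "s j = (if j < p then j else Suc j)" for j
    have bij: "bij_betw s {..<m'} ({..<m} - {p})"
    proof (rule bij_betw_byWitness[where f' = "\<lambda>j. if j < p then j else j - 1"])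
      show "s ` {..<m'} \<subseteq> {..<m} - {p}" using p m by (auto simp: s_def)
      show "(\<lambda>j. if j < p then j else j - 1) ` ({..<m} - {p}) \<subseteq> {..<m'}" using p m by auto
    qed (auto simp: s_def)
    define c where "c j = poly (F j) z / poly (F p) z" for j
    have "\<exists>G. F j - smult (c j) (F p) = [:-z, 1:] * G" for j
    proof -
      have "poly (F j - smult (c j) (F p)) z = 0" using p by (simp add: c_def)
      then show ?thesis unfolding poly_eq_0_iff_dvd dvd_def .
    qed
    then have "\<forall>j. \<exists>G. F j - smult (c j) (F p) = [:-z, 1:] * G" ..
    then obtain G where G: "\<And>j. F j - smult (c j) (F p) = [:-z, 1:] * G j"
      unfolding choice_iff by blast
    from Suc.hyps(1)[OF dH'[symmetric] nz m', of "\<lambda>j. G (s j)"]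
    obtain v where v: "\<exists>j<m'. v j \<noteq> 0" "H' dvd (\<Sum>j<m'. smult (v j) (G (s j)))"
      by blast
    \<comment> \<open>At the pivot, \<open>w\<close> collects with opposite sign all multiples of
      \<open>F p\<close> that the elimination introduced, so that only the multiple of x - z
      survives.\<close>
    define w where "w j = (if j = p then - (\<Sum>i<m'. v i * c (s i)) else v (if j < p then j else j - 1))" for j
    have ws: "w (s i) = v i" for i by (auto simp: w_def s_def)
    have "(\<Sum>j<m. smult (w j) (F j)) = smult (w p) (F p) + (\<Sum>j\<in>{..<m} - {p}. smult (w j) (F j))"
      using p by (subst sum.remove[of _ p]) auto
    also have "(\<Sum>j\<in>{..<m} - {p}. smult (w j) (F j)) = (\<Sum>i<m'. smult (v i) (F (s i)))"
      by (subst sum.reindex_bij_betw[OF bij, symmetric]) (simp add: ws)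
    also have "\<dots> = (\<Sum>i<m'. smult (v i * c (s i)) (F p) + smult (v i) ([:-z, 1:] * G (s i)))"
      by (intro sum.cong refl, subst G[symmetric]) (simp add: smult_diff_right)
    also have "\<dots> = smult (\<Sum>i<m'. v i * c (s i)) (F p) + [:-z, 1:] * (\<Sum>i<m'. smult (v i) (G (s i)))"
      by (simp add: sum.distrib smult_sum sum_distrib_left del: mult_pCons_left)
    finally have "(\<Sum>j<m. smult (w j) (F j)) = [:-z, 1:] * (\<Sum>i<m'. smult (v i) (G (s i)))"
      by (simp add: w_def del: mult_pCons_left)
    then have "H dvd (\<Sum>j<m. smult (w j) (F j))"
      using v(2) H' mult_dvd_mono[OF dvd_refl] by metis
    moreover have "\<exists>j<m. w j \<noteq> 0"
    proof -
      obtain i where i: "i < m'" "v i \<noteq> 0" using v(1) by blast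
      then have "s i < m" using bij_betwE[OF bij] by auto
      with i show ?thesis using ws[of i] by metis
    qed
    ultimately show ?thesis by blast
  qed
qed

text \<open>At a zero of a + b y one has y = -a/b, so the divisibility says that \<alpha> + \<beta>
  y vanishes at the zeros over the roots of \<open>H\<close>. There are k + 1 coefficients in
  \<alpha> and k - 1 in \<beta>, hence 2k unknowns; the bound k - 2 on \<beta> reflects that y
  itself has delta equal to 2.\<close>

lemma small_solution_of_congruence:
  fixes H a b :: "complex poly"
  assumes "H \<noteq> 0" and "degree H < 2 * k" and "k \<ge> 2"
  obtains \<alpha> \<beta> where "\<alpha> \<noteq> 0 \<or> \<beta> \<noteq> 0" "degree \<alpha> \<le> k" "degree \<beta> \<le> k - 2" "H dvd \<alpha> * b - \<beta> * a"
proof -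
  define F where "F j = (if j \<le> k then monom 1 j * b else - (monom 1 (j - Suc k) * a))" for j
  obtain v where v: "\<exists>j<2*k. v j \<noteq> 0" "H dvd (\<Sum>j<2*k. smult (v j) (F j))"
    using poly_combination_dvd[OF assms(1,2), of F] by blast
  define \<alpha> where "\<alpha> = (\<Sum>j<Suc k. monom (v j) j)"
  define \<beta> where "\<beta> = (\<Sum>j<k-1. monom (v (Suc k + j)) j)"
  have split: "(\<Sum>j<2*k. h j) = (\<Sum>j<Suc k. h j) + (\<Sum>j<k-1. h (Suc k + j))" for h :: "nat \<Rightarrow> complex poly"
  proof -
    have *: "(\<Sum>j<p+n. h j) = (\<Sum>j<p. h j) + (\<Sum>j<n. h (p + j))" for p n
      by (induction n) (simp_all add: add.assoc)
    have "2 * k = Suc k + (k - 1)" using assms(3) by simp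
    then show ?thesis using *[of "Suc k" "k - 1"] by (simp only:)
  qed
  have m: "smult c (monom 1 j * p) = monom c j * p" for c j and p :: "complex poly"
    by (metis mult.right_neutral mult_smult_left smult_monom)
  have "(\<Sum>j<2*k. smult (v j) (F j)) = \<alpha> * b - \<beta> * a"
    unfolding split \<alpha>_def \<beta>_def sum_distrib_right
    by (simp add: F_def m sum_negf del: sum.lessThan_Suc)
  moreover have "\<alpha> \<noteq> 0 \<or> \<beta> \<noteq> 0"
  proof -
    obtain j where j: "j < 2 * k" "v j \<noteq> 0" using v(1) by blast
    show ?thesis
    proof (cases "j < Suc k")
      case True
      then have "coeff \<alpha> j = v j" by (simp add: \<alpha>_def coeff_sum del: sum.lessThan_Suc)
      with j show ?thesis by auto
    next
      case False
      then have "coeff \<beta> (j - Suc k) = v j" using j by (auto simp: \<beta>_def coeff_sum)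
      with j show ?thesis by auto
    qed
  qed
  moreover have "degree \<alpha> \<le> k"
    unfolding \<alpha>_def by (intro degree_sum_le) (auto intro: order.trans[OF degree_monom_le])
  moreover have "degree \<beta> \<le> k - 2"
    unfolding \<beta>_def by (intro degree_sum_le) (auto intro: order.trans[OF degree_monom_le])
  ultimately show thesis using that v(2) by metis
qed

text \<open>A real polynomial equals its own conjugate, so a divisor \<open>H\<close> brings the
  divisor \<open>cnjp H\<close> along, and coprime divisors multiply.\<close>

lemma cpoly_dvd_of_hermitian_factor:
  assumes "cpoly N = H * cnjp H" and "coprime H (cnjp H)" and "H dvd cpoly W"
  shows "N dvd W"
proof -
  obtain G where "cpoly W = H * G" using assms(3) by (metis dvdE)
  then have "cpoly W = cnjp H * cnjp G" by (metis cnjp_cpoly cnjp_mult)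
  then have "cnjp H dvd cpoly W" by simp
  then have "cpoly N dvd cpoly W" unfolding assms(1) by (intro divides_mult assms)
  then show ?thesis by (simp add: cpoly_dvd_cpoly_iff)
qed

lemma coprime_complex_poly:
  fixes p r :: "complex poly"
  assumes "p \<noteq> 0" and "\<And>z. poly p z = 0 \<Longrightarrow> poly r z \<noteq> 0"
  shows "coprime p r"
proof (rule coprimeI)
  fix d assume d: "d dvd p" "d dvd r"
  show "is_unit d"
  proof (cases "degree d = 0")
    case True
    moreover have "d \<noteq> 0" using d(1) assms(1) by auto
    ultimately show ?thesis by (simp add: is_unit_iff_degree)
  next
    case False
    then have "\<not> constant (poly d)" by (simp add: constant_degree)
    then obtain z where "poly d z = 0" using fundamental_theorem_of_algebra by blast
    then show ?thesis using assms(2)[of z] d by (metis dvdE mult_zero_left poly_mult)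
  qed
qed

text \<open>
  With $N = H \overline{H}$ the norm of $f = a + b y$, the roots of
  $H$ are one half of the zeros of $f$. If $h = \alpha + \beta y$ vanishes on this half, then
  $h \overline{h} = f g$, and counting poles gives $\delta(g) \<le> 1$, so that $g$ lies in
  $\mathbb{R}[x]$.
\<close>

lemma linear_multiple_is_hermitian_square:
  fixes q a b :: "real poly"
  assumes q: "degree q = 4" "lead_coeff q = 1"
    and k: "k \<ge> 2" and da: "degree a = 2 * k - 1" and db: "degree b \<le> 2 * k - 3"
    and pos: "\<And>x y. y\<^sup>2 + poly q x = 0 \<Longrightarrow> poly a x + poly b x * y > 0"
    and coprime: "\<And>z. poly (cpoly a) z = 0 \<Longrightarrow> poly (cpoly b) z \<noteq> 0"
  shows "\<exists>\<alpha> \<beta> g. (\<alpha> \<noteq> 0 \<or> \<beta> \<noteq> 0) \<and> degree \<alpha> \<le> k \<and> degree \<beta> \<le> k - 2 \<and> degree g \<le> 1 \<and>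
    (\<forall>x. poly a x * poly g x =
       (cmod (poly \<alpha> (of_real x)))\<^sup>2 - poly q x * (cmod (poly \<beta> (of_real x)))\<^sup>2) \<and>
    (\<forall>x. poly b x * poly g x = 2 * Re (poly \<alpha> (of_real x) * cnj (poly \<beta> (of_real x))))"
proof -
  define N where "N = a\<^sup>2 + q * b\<^sup>2"
  \<comment> \<open>Where q \<le> 0, the norm is the product of the values of f at the two real
    points over x; where q > 0, it is a sum of two nonnegative terms that have no common
    zero.\<close>
  have Npos: "poly N x > 0" for x
  proof (cases "poly q x \<le> 0")
    case True
    define y where "y = sqrt (- poly q x)"
    have y: "y\<^sup>2 = - poly q x" using True by (simp add: y_def)
    have "poly N x = (poly a x + poly b x * y) * (poly a x + poly b x * (- y))"
      using y unfolding N_def poly_add poly_mult poly_power by algebra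
    then show ?thesis using pos[of y x] pos[of "-y" x] y by simp
  next
    case False
    moreover have "poly a x \<noteq> 0 \<or> poly b x \<noteq> 0"
      using coprime[of "complex_of_real x"] by (auto simp: poly_cpoly_of_real)
    ultimately show ?thesis
      by (auto simp: N_def intro: add_pos_nonneg add_nonneg_pos)
  qed
  \<comment> \<open>At x^(4k-2) the terms \<open>a\<^sup>2\<close> and \<open>q * b\<^sup>2\<close>
    both contribute squares, because q is monic. Hence they cannot cancel.\<close>
  have dN: "degree N = 4 * k - 2"
  proof (rule antisym)
    have "degree (a\<^sup>2) \<le> 4 * k - 2" using degree_power_le[of a 2] da by simp
    moreover have "degree (q * b\<^sup>2) \<le> 4 * k - 2"
      using degree_mult_le[of q "b\<^sup>2"] degree_power_le[of b 2] db q(1) k by simp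
    ultimately show "degree N \<le> 4 * k - 2" unfolding N_def by (rule degree_add_le)
    have "a \<noteq> 0" using da k by auto
    have c: "coeff (p * r) (i + j) = coeff p i * coeff r j" if "degree p \<le> i" "degree r \<le> j"
      for p r :: "real poly" and i j
    proof (cases "degree p = i \<and> degree r = j")
      case False
      then have "degree (p * r) < i + j" "degree p < i \<or> degree r < j"
        using that degree_mult_le[of p r] by linarith+
      then show ?thesis by (auto simp: coeff_eq_0)
    qed (auto simp: coeff_mult_degree_sum[symmetric])
    have "coeff (a\<^sup>2) (4 * k - 2) = (lead_coeff a)\<^sup>2"
    proof -
      have "4 * k - 2 = (2 * k - 1) + (2 * k - 1)" using k by simp
      then show ?thesis
        using c[of a "2 * k - 1" a "2 * k - 1"] by (simp only: power2_eq_square da le_refl simp_thms)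
    qed
    moreover have "coeff (q * b\<^sup>2) (4 * k - 2) = (coeff b (2 * k - 3))\<^sup>2"
    proof -
      have "4 * k - 2 = 4 + ((2 * k - 3) + (2 * k - 3))" using k by simp
      moreover have "degree (b * b) \<le> (2 * k - 3) + (2 * k - 3)"
        using degree_mult_le[of b b] db by linarith
      ultimately show ?thesis
        using c[of q 4 "b * b" "(2 * k - 3) + (2 * k - 3)"] c[of b "2 * k - 3" b "2 * k - 3"] db q
        by (simp add: power2_eq_square)
    qed
    moreover have "(lead_coeff a)\<^sup>2 > 0" using \<open>a \<noteq> 0\<close> by simp
    ultimately have "coeff N (4 * k - 2) \<noteq> 0"
      by (simp add: N_def)
    then show "4 * k - 2 \<le> degree N" by (rule le_degree)
  qed
  then have Nnz: "N \<noteq> 0" using k by auto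
  obtain H where H: "cpoly N = H * cnjp H" "\<And>z. poly H z = 0 \<Longrightarrow> Im z \<ge> 0" "2 * degree H = degree N"
    using nonneg_poly_hermitian_square[OF Nnz] Npos by (metis less_imp_le)
  have dH: "degree H = 2 * k - 1" using H(3) dN by simp
  then have Hnz: "H \<noteq> 0" using k by auto
  have cN: "cpoly N = (cpoly a)\<^sup>2 + cpoly q * (cpoly b)\<^sup>2"
    by (simp add: N_def cpoly_add cpoly_mult power2_eq_square)
  \<comment> \<open>Since N has no real root, the roots of \<open>H\<close> lie strictly above the
    real axis and those of its conjugate strictly below.\<close>
  have copH: "coprime H (cnjp H)"
  proof (rule coprime_complex_poly[OF Hnz])
    fix z assume z: "poly H z = 0"
    show "poly (cnjp H) z \<noteq> 0"
    proof
      assume "poly (cnjp H) z = 0"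
      then have "Im z = 0" using H(2)[OF z] H(2)[of "cnj z"] by (simp add: poly_cnjp)
      then have "z = complex_of_real (Re z)" by (simp add: complex_eq_iff)
      moreover have "poly (cpoly N) z = 0" using z H(1) by simp
      ultimately have "poly N (Re z) = 0" by (metis of_real_eq_0_iff poly_cpoly_of_real)
      with Npos[of "Re z"] show False by simp
    qed
  qed
  have copb: "coprime H (cpoly b)"
  proof (rule coprime_complex_poly[OF Hnz])
    fix z assume z: "poly H z = 0"
    show "poly (cpoly b) z \<noteq> 0"
    proof
      assume b: "poly (cpoly b) z = 0"
      have "poly (cpoly N) z = 0" using z H(1) by simp
      with b have "poly (cpoly a) z = 0" by (simp add: cN)
      with coprime b show False by blast
    qed
  qed
  obtain \<alpha> \<beta> where ab: "\<alpha> \<noteq> 0 \<or> \<beta> \<noteq> 0" "degree \<alpha> \<le> k" "degree \<beta> \<le> k - 2"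
    and dvd1: "H dvd \<alpha> * cpoly b - \<beta> * cpoly a"
    using small_solution_of_congruence[of H k "cpoly b" "cpoly a"] Hnz dH k by auto
  \<comment> \<open>The product (a + b y)(\<alpha> - \<beta> y) has this polynomial as its part free
    of y, and \<alpha> b - \<beta> a as its coefficient of y. Divisibility passes from the second to
    the first because b is prime to \<open>H\<close>.\<close>
  have dvd2: "H dvd cpoly a * \<alpha> + cpoly q * cpoly b * \<beta>"
  proof -
    have "cpoly b * (cpoly a * \<alpha> + cpoly q * cpoly b * \<beta>)
        = cpoly a * (\<alpha> * cpoly b - \<beta> * cpoly a) + \<beta> * (H * cnjp H)"
      unfolding H(1)[symmetric] cN by (simp add: algebra_simps power2_eq_square)
    moreover have "H dvd \<dots>" using dvd1 by (simp add: dvd_add)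
    ultimately show ?thesis using copb by (metis coprime_dvd_mult_right_iff)
  qed
  have dvd1': "H dvd - (\<alpha> * cpoly b - \<beta> * cpoly a)" using dvd1 by (simp only: dvd_minus_iff)
  define \<alpha>1 \<alpha>2 \<beta>1 \<beta>2 where "\<alpha>1 = map_poly Re \<alpha>" and "\<alpha>2 = map_poly Im \<alpha>"
    and "\<beta>1 = map_poly Re \<beta>" and "\<beta>2 = map_poly Im \<beta>"
  \<comment> \<open>X + Y y is the Hermitian square of \<alpha> + \<beta> y, reduced by y^2 =
    -q.\<close>
  define X where "X = \<alpha>1\<^sup>2 + \<alpha>2\<^sup>2 - q * (\<beta>1\<^sup>2 + \<beta>2\<^sup>2)"
  define Y where "Y = smult 2 (\<alpha>1 * \<beta>1 + \<alpha>2 * \<beta>2)"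
  have X: "poly X x = (cmod (poly \<alpha> (of_real x)))\<^sup>2 - poly q x * (cmod (poly \<beta> (of_real x)))\<^sup>2"
    and Y: "poly Y x = 2 * Re (poly \<alpha> (of_real x) * cnj (poly \<beta> (of_real x)))" for x
    by (simp_all add: X_def Y_def \<alpha>1_def \<alpha>2_def \<beta>1_def \<beta>2_def poly_map_poly_Re poly_map_poly_Im cmod_power2)
  have peq: "p = r" if "\<And>x. poly p (complex_of_real x) = poly r (complex_of_real x)" for p r
  proof (rule poly_eq_from_infinite)
    have "range complex_of_real \<subseteq> {x. poly p x = poly r x}" using that by auto
    moreover have "infinite (range complex_of_real)"
      by (simp add: finite_image_iff inj_of_real infinite_UNIV_char_0)
    ultimately show "infinite {x. poly p x = poly r x}" using infinite_super by blast
  qed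
  have cX: "cpoly X = \<alpha> * cnjp \<alpha> - cpoly q * (\<beta> * cnjp \<beta>)"
    by (rule peq) (simp add: poly_cpoly_of_real X poly_cnjp flip: complex_norm_square)
  have cY: "cpoly Y = \<alpha> * cnjp \<beta> + \<beta> * cnjp \<alpha>"
    by (rule peq) (simp add: poly_cpoly_of_real Y poly_cnjp complex_eq_iff)
  \<comment> \<open>The quotient of X + Y y by f is computed as (X + Y y)(a - b y) / N. The two
    components of this numerator are Y a - X b and X a + q Y b, and both turn out to be divisible by
    N.\<close>
  have "cpoly (Y * a - X * b) = cnjp \<alpha> * (- (\<alpha> * cpoly b - \<beta> * cpoly a)) + cnjp \<beta> * (cpoly a * \<alpha> + cpoly q * cpoly b * \<beta>)"
    by (simp add: cpoly_mult cpoly_diff cX cY algebra_simps)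
  moreover have "H dvd \<dots>" by (rule dvd_add[OF dvd_mult[OF dvd1'] dvd_mult[OF dvd2]])
  ultimately have "N dvd Y * a - X * b"
    using cpoly_dvd_of_hermitian_factor[OF H(1) copH] by simp
  have "cpoly (X * a + q * Y * b) = cnjp \<alpha> * (cpoly a * \<alpha> + cpoly q * cpoly b * \<beta>)
     + cpoly q * cnjp \<beta> * (\<alpha> * cpoly b - \<beta> * cpoly a)"
    by (simp add: cpoly_mult cpoly_add cX cY algebra_simps)
  moreover have "H dvd \<dots>" by (rule dvd_add[OF dvd_mult[OF dvd2] dvd_mult[OF dvd1]])
  ultimately have "N dvd X * a + q * Y * b"
    using cpoly_dvd_of_hermitian_factor[OF H(1) copH] by simp
  then obtain g where g: "X * a + q * Y * b = N * g" by (metis dvdE)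
  have d1: "degree \<alpha>1 \<le> k" "degree \<alpha>2 \<le> k" "degree \<beta>1 \<le> k - 2" "degree \<beta>2 \<le> k - 2"
    unfolding \<alpha>1_def \<alpha>2_def \<beta>1_def \<beta>2_def
    using ab degree_map_poly_Re_le degree_map_poly_Im_le order.trans by blast+
  have dm: "degree (p * r) \<le> i + j" if "degree p \<le> i" "degree r \<le> j" for p r :: "real poly" and i j
    using that degree_mult_le[of p r] by linarith
  have dX: "degree X \<le> 2 * k"
    unfolding X_def power2_eq_square
  proof (intro degree_diff_le degree_add_le)
    show "degree (\<alpha>1 * \<alpha>1) \<le> 2 * k" "degree (\<alpha>2 * \<alpha>2) \<le> 2 * k"
      using dm[OF d1(1) d1(1)] dm[OF d1(2) d1(2)] by auto
    have "degree (\<beta>1 * \<beta>1 + \<beta>2 * \<beta>2) \<le> (k - 2) + (k - 2)"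
      using dm[OF d1(3) d1(3)] dm[OF d1(4) d1(4)] by (rule degree_add_le)
    from dm[OF _ this, of q 4] show "degree (q * (\<beta>1 * \<beta>1 + \<beta>2 * \<beta>2)) \<le> 2 * k"
      using q(1) k by simp
  qed
  have dY: "degree Y \<le> 2 * k - 2"
  proof -
    have "degree (\<alpha>1 * \<beta>1 + \<alpha>2 * \<beta>2) \<le> k + (k - 2)"
      using dm[OF d1(1) d1(3)] dm[OF d1(2) d1(4)] by (rule degree_add_le)
    then show ?thesis using k degree_smult_le[of 2 "\<alpha>1 * \<beta>1 + \<alpha>2 * \<beta>2"] by (simp add: Y_def)
  qed
  \<comment> \<open>The component at y has degree at most 4k - 3, less than deg N = 4k - 2, so it
    vanishes. The other has degree at most 4k - 1, which leaves a linear quotient.\<close>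
  have YX: "Y * a = X * b"
  proof (rule ccontr)
    assume "Y * a \<noteq> X * b"
    then have "degree N \<le> degree (Y * a - X * b)"
      by (intro dvd_imp_degree_le \<open>N dvd Y * a - X * b\<close>) simp
    also have "\<dots> \<le> 4 * k - 3"
      using dm[OF dY, of a "2*k-1"] dm[OF dX db] da k by (intro degree_diff_le) auto
    finally show False using dN k by simp
  qed
  have "degree g \<le> 1"
  proof (cases "g = 0")
    case False
    have "degree N + degree g = degree (X * a + q * Y * b)"
      using False Nnz by (simp add: g degree_mult_eq)
    also have "\<dots> \<le> 4 * k - 1"
      using dm[OF dX, of a "2*k-1"] dm[OF dm[of q 4 Y] db, of "2*k-2"] dY da k q(1)
      by (intro degree_add_le) auto
    finally show ?thesis using dN k by simp
  qed simp
  moreover have "a * g = X" "b * g = Y"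
  proof -
    have "N * X = a * (X * a) + q * b * (X * b)" by (simp add: N_def algebra_simps power2_eq_square)
    also have "\<dots> = a * (X * a + q * Y * b)" unfolding YX[symmetric] by (simp add: algebra_simps)
    also have "\<dots> = N * (a * g)" unfolding g by (simp only: mult_ac)
    finally have 1: "N * X = N * (a * g)" .
    have "N * Y = a * (Y * a) + q * b * Y * b" by (simp add: N_def algebra_simps power2_eq_square)
    also have "\<dots> = b * (X * a + q * Y * b)" unfolding YX by (simp add: algebra_simps)
    also have "\<dots> = N * (b * g)" unfolding g by (simp only: mult_ac)
    finally have 2: "N * Y = N * (b * g)" .
    from 1 2 show "a * g = X" "b * g = Y" using Nnz by simp_all
  qed
  then have "poly a x * poly g x = poly X x" "poly b x * poly g x = poly Y x" for x
    by (metis poly_mult)+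
  ultimately show ?thesis
    using ab X Y by (intro exI[of _ \<alpha>] exI[of _ \<beta>] exI[of _ g]) simp
qed

section \<open>Certificates for linear polynomials\<close>

lemma continuous_on_poly_real: "continuous_on S (poly (p :: real poly))"
  by (intro continuous_at_imp_continuous_on) simp

lemma positive_poly_bounded_below:
  fixes p :: "real poly"
  assumes "\<And>x. x \<ge> 0 \<Longrightarrow> poly p x > 0"
  obtains m where "m > 0" "\<And>x. x \<ge> 0 \<Longrightarrow> poly p x \<ge> m"
proof -
  have "p \<noteq> 0" using assms[of 0] by auto
  have "lead_coeff p > 0"
  proof (rule ccontr)
    assume "\<not> lead_coeff p > 0"
    then have "lead_coeff (- p) > 0" using \<open>p \<noteq> 0\<close> by (simp add: less_le)
    then obtain n where "\<forall>x\<ge>n. poly (- p) x \<ge> lead_coeff (- p)"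
      using poly_pinfty_gt_lc by blast
    then have "poly (- p) (max n 0) > 0"
      using \<open>lead_coeff (- p) > 0\<close> by (meson less_le_trans max.cobounded1)
    then show False using assms[of "max n 0"] by simp
  qed
  then obtain n where n: "\<And>x. x \<ge> n \<Longrightarrow> poly p x \<ge> lead_coeff p"
    using poly_pinfty_gt_lc by blast
  have "compact {0..max n 0}" "{0..max n 0} \<noteq> {}" by auto
  from continuous_attains_inf[OF this continuous_on_poly_real, of p]
  obtain x0 where x0: "x0 \<in> {0..max n 0}" "\<And>x. x \<in> {0..max n 0} \<Longrightarrow> poly p x0 \<le> poly p x"
    by blast
  show thesis
  proof (rule that[of "min (lead_coeff p) (poly p x0)"])
    show "min (lead_coeff p) (poly p x0) > 0"
      using \<open>lead_coeff p > 0\<close> assms[of x0] x0(1) by simp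
    show "min (lead_coeff p) (poly p x0) \<le> poly p x" if "x \<ge> 0" for x
      using n[of x] x0(2)[of x] that by (cases "x \<ge> n") auto
  qed
qed

lemma poly_bounded_on_unit:
  fixes p :: "real poly"
  obtains B where "B \<ge> 0" "\<And>x. \<bar>x\<bar> \<le> 1 \<Longrightarrow> \<bar>poly p x\<bar> \<le> B"
proof -
  have "compact {-1..1::real}" "{-1..1::real} \<noteq> {}" by auto
  from continuous_attains_sup[OF this continuous_on_rabs[OF continuous_on_poly_real], of p]
  obtain x0 where x0: "\<And>x. x \<in> {-1..1::real} \<Longrightarrow> \<bar>poly p x\<bar> \<le> \<bar>poly p x0\<bar>"
    by blast
  show thesis by (rule that[of "\<bar>poly p x0\<bar>"]) (use x0 in \<open>auto simp: abs_le_iff\<close>)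
qed

text \<open>
  With $q = z p$ one needs $p D \<ge> 1$ for $z > 0$ but $p D \<le> 1$ on $[-1,0]$. A high power of
  $1 + z$, normalized at $0$, is steep enough to cross the value $1/p$ in this way.
\<close>

lemma linear_certificate_at_simple_root:
  fixes q :: "real poly"
  assumes q0: "poly q 0 = 0" and "poly (pderiv q) 0 \<noteq> 0"
    and pos: "\<And>z. z > 0 \<Longrightarrow> poly q z > 0"
    and nonneg: "\<And>z. z \<le> -1 \<Longrightarrow> poly q z \<ge> 0"
  obtains D where "\<And>z. poly D z \<ge> 0" "\<And>z. - z + poly q z * poly D z \<ge> 0"
proof -
  obtain p where p: "q = [:0, 1:] * p" using q0 poly_eq_0_iff_dvd[of q 0] by (auto elim: dvdE)
  then have qz: "poly q z = z * poly p z" for z by simp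
  have "poly (pderiv q) 0 = poly p 0" by (simp add: p pderiv_pCons)
  then have p0: "poly p 0 \<noteq> 0" using assms(2) by simp
  have ppos': "poly p z > 0" if "z > 0" for z
    using pos[OF that] that by (simp add: qz zero_less_mult_iff)
  have "poly p 0 \<ge> 0"
  proof -
    have "(poly p \<longlongrightarrow> poly p 0) (at 0)"
      by (rule isContD[unfolded isCont_def]) (simp add: isCont_def[symmetric])
    then have "(poly p \<longlongrightarrow> poly p 0) (at_right 0)" by (auto simp: filterlim_at_split)
    moreover have "eventually (\<lambda>x. poly p x \<ge> 0) (at_right 0)"
      unfolding eventually_at_filter by (intro always_eventually) (simp add: ppos' less_imp_le)
    ultimately show ?thesis
      using tendsto_lowerbound[of "poly p" "poly p 0" "at_right 0" 0] by simp
  qed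
  with p0 have p0: "poly p 0 > 0" by simp
  with ppos' have ppos: "poly p z > 0" if "z \<ge> 0" for z
    using that by (cases "z = 0") auto
  obtain m where m: "m > 0" "\<And>z. z \<ge> 0 \<Longrightarrow> poly p z \<ge> m"
    using positive_poly_bounded_below[of p] ppos by blast
  obtain r where "p - [:poly p 0:] = [:0, 1:] * r"
    using poly_eq_0_iff_dvd[of "p - [:poly p 0:]" 0] by (auto elim: dvdE)
  then have pr: "poly (p - [:poly p 0:]) z = poly ([:0, 1:] * r) z" for z by (rule arg_cong)
  have r: "poly p z = poly p 0 + z * poly r z" for z
    using pr[of z] by (simp add: diff_eq_eq)
  obtain B where B: "B \<ge> 0" "\<And>z. \<bar>z\<bar> \<le> 1 \<Longrightarrow> \<bar>poly r z\<bar> \<le> B"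
    using poly_bounded_on_unit by blast
  \<comment> \<open>One requirement for each range of z: k m \<ge> B serves 0 \<le> z \<le> 1, k m
    \<ge> p(0) serves z > 1, and k p(0) \<ge> B serves -1 < z < 0.\<close>
  obtain k :: nat where k: "real k \<ge> max (B / m) (max (poly p 0 / m) (B / poly p 0))"
    using real_arch_simple by blast
  then have k1: "real k * m \<ge> B" and k2: "real k * m \<ge> poly p 0" and k3: "real k * poly p 0 \<ge> B"
    using m(1) p0 by (simp_all add: pos_divide_le_eq)
  \<comment> \<open>The even exponent makes D nonnegative on the whole line.\<close>
  define D where "D = smult (1 / poly p 0) ([:1, 1:] ^ (2 * k))"
  have Dz: "poly D z = (1 + z) ^ (2 * k) / poly p 0" for z by (simp add: D_def)
  have D0: "poly D z \<ge> 0" for z using p0 by (simp add: Dz)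
  have "- z + poly q z * poly D z \<ge> 0" for z
  proof -
    consider "z \<ge> 0" | "-1 < z" "z < 0" | "z \<le> -1" by linarith
    then show ?thesis
    proof cases
      case 1
      have "poly p 0 \<le> poly p z * (1 + 2 * real k * z)"
      proof (cases "z \<le> 1")
        case True
        have "z * poly r z \<ge> - (z * B)"
          using B(2)[of z] mult_left_mono[of "- B" "poly r z" z] 1 True by (simp add: abs_le_iff)
        then have "poly p z \<ge> poly p 0 - z * B" by (simp add: r[of z])
        moreover have "z * B \<le> z * (real k * m)" using k1 1 by (intro mult_left_mono)
        moreover have "z * (real k * m) \<le> z * (real k * poly p z)"
          using m(2)[OF 1] 1 by (intro mult_left_mono) auto
        moreover have "0 \<le> z * (real k * poly p z)" using 1 ppos[OF 1] by simp
        ultimately show ?thesis by (simp add: algebra_simps)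
      next
        case False
        have "poly p 0 \<le> real k * m" by (rule k2)
        also have "\<dots> \<le> real k * poly p z" using m(2)[OF 1] by (intro mult_left_mono) auto
        also have "\<dots> \<le> z * (real k * poly p z)"
          using False ppos[OF 1] mult_right_mono[of 1 z "real k * poly p z"] by simp
        also have "\<dots> \<le> poly p z * (1 + 2 * real k * z)"
          using 1 ppos[OF 1] by (simp add: algebra_simps)
        finally show ?thesis .
      qed
      also have "\<dots> \<le> poly p z * (1 + z) ^ (2 * k)"
        using Bernoulli_inequality[of z "2 * k"] 1 ppos[OF 1] by (intro mult_left_mono) (simp_all add: mult.assoc)
      finally have "poly p z * poly D z \<ge> 1" using p0 by (simp add: Dz)
      then have "z * (poly p z * poly D z) \<ge> z * 1" using 1 by (intro mult_left_mono)
      then show ?thesis by (simp add: qz mult.assoc)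
    next
      case 2
      have "z * poly r z \<le> - z * B"
        using B(2)[of z] mult_left_mono_neg[of "-B" "poly r z" z] 2 by (simp add: abs_le_iff)
      also have "\<dots> \<le> - z * (2 * real k * poly p 0)" using 2 k3 B(1) by (intro mult_left_mono) auto
      finally have "poly p z \<le> poly p 0 * (1 + real (2 * k) * (- z))" by (simp add: r[of z] algebra_simps)
      also have "\<dots> \<le> poly p 0 * (1 - z) ^ (2 * k)"
        using Bernoulli_inequality[of "- z" "2 * k"] 2 p0 by (intro mult_left_mono) simp_all
      \<comment> \<open>Bernoulli bounds p by a power of 1 - z, not by a reciprocal power of 1 + z.
        The two are compared through (1 - z)(1 + z) = 1 - z^2 \<le> 1.\<close>
      finally have "poly p z * (1 + z) ^ (2 * k) \<le> poly p 0 * (1 - z) ^ (2 * k) * (1 + z) ^ (2 * k)"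
        using 2 by (intro mult_right_mono) auto
      also have "\<dots> = poly p 0 * ((1 - z) * (1 + z)) ^ (2 * k)"
        by (simp only: power_mult_distrib mult.assoc)
      also have "(1 - z) * (1 + z) = 1 - z\<^sup>2"
        by (simp add: power2_eq_square algebra_simps)
      also have "poly p 0 * (1 - z\<^sup>2) ^ (2 * k) \<le> poly p 0 * 1"
      proof (intro mult_left_mono power_le_one)
        have "z\<^sup>2 \<le> 1" using 2 by (subst abs_square_le_1) linarith
        then show "0 \<le> 1 - z\<^sup>2" by simp
      qed (use p0 in auto)
      finally have "poly p z * poly D z \<le> 1" using p0 by (simp add: Dz)
      then have "z * (poly p z * poly D z) \<ge> z * 1" using 2 by (intro mult_left_mono_neg) auto
      then show ?thesis by (simp add: qz mult.assoc)
    next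
      case 3
      then show ?thesis using mult_nonneg_nonneg[OF nonneg[OF 3] D0[of z]] by linarith
    qed
  qed
  with D0 that show thesis by blast
qed

section \<open>Bounded sums of squares are closed\<close>

text \<open>The number of squares and both degrees are fixed so that the coefficients range over a
  finite-dimensional space, where compactness applies. For d \<ge> 2 the degree bounds amount to
  delta \<le> d for every summand; below 2 the truncated \<open>d - 2\<close> would admit too
  much.\<close>

definition curve_sos :: "real poly \<Rightarrow> nat \<Rightarrow> nat \<Rightarrow> real poly \<Rightarrow> real poly \<Rightarrow> bool" where
  "curve_sos q r d a b \<longleftrightarrow> (\<exists>c e :: nat \<Rightarrow> real poly.
     (\<forall>i<r. degree (c i) \<le> d \<and> degree (e i) \<le> d - 2) \<and>
     a = (\<Sum>i<r. (c i)\<^sup>2 - q * (e i)\<^sup>2) \<and> b = (\<Sum>i<r. 2 * c i * e i))"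

lemma bounded_family_convergent_subseq:
  fixes X :: "'i \<Rightarrow> nat \<Rightarrow> real"
  assumes "finite I" and "\<And>i n. i \<in> I \<Longrightarrow> \<bar>X i n\<bar> \<le> B"
  shows "\<exists>s. strict_mono s \<and> (\<forall>i\<in>I. convergent (\<lambda>n. X i (s n)))"
  using assms
proof (induction I rule: finite_induct)
  case empty
  then show ?case using strict_mono_id by blast
next
  case (insert i I)
  then obtain s where s: "strict_mono s" "\<And>j. j \<in> I \<Longrightarrow> convergent (\<lambda>n. X j (s n))" by auto
  obtain t where t: "strict_mono t" "monoseq (\<lambda>n. X i (s (t n)))"
    using seq_monosub[of "\<lambda>n. X i (s n)"] by blast
  have "Bseq (\<lambda>n. X i (s (t n)))" using insert.prems by (intro BseqI'[of _ B]) simp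
  then have "convergent (\<lambda>n. X i (s (t n)))" using t(2) by (rule Bseq_monoseq_convergent)
  moreover have "convergent (\<lambda>n. X j (s (t n)))" if "j \<in> I" for j
    using convergent_subseq_convergent[OF s(2)[OF that] t(1)] by (simp add: o_def)
  moreover have "strict_mono (\<lambda>n. s (t n))"
    using strict_mono_o[OF s(1) t(1)] by (simp add: o_def)
  ultimately show ?case by blast
qed

text \<open>A polynomial of degree at most d is determined by d + 1 values, and boundedness follows
  by Newton interpolation: the quotient of p - p(s) by x - s is at most 2M/m on the remaining
  points, where m is their least distance from s. The bound \<open>M\<close> changes in the
  recursion and is therefore generalized.\<close>

lemma poly_coeff_bounded_by_values:
  fixes S :: "real set"
  assumes "finite S" and "d < card S"
  shows "\<exists>B. \<forall>p. degree p \<le> d \<longrightarrow> (\<forall>x\<in>S. \<bar>poly p x\<bar> \<le> M) \<longrightarrow> (\<forall>i. \<bar>coeff p i\<bar> \<le> B)"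
  using assms
proof (induction d arbitrary: S M)
  case 0
  then obtain s where "s \<in> S" by (metis card.empty ex_in_conv less_numeral_extra(3))
  have "\<bar>coeff p i\<bar> \<le> \<bar>M\<bar>" if p: "degree p \<le> 0" "\<forall>x\<in>S. \<bar>poly p x\<bar> \<le> M" for p i
  proof -
    obtain c where c: "p = [:c:]" using p(1) by (metis degree_eq_zeroE le_zero_eq)
    then have "\<bar>c\<bar> \<le> M" using p(2) \<open>s \<in> S\<close> by auto
    then show ?thesis by (auto simp: c coeff_pCons split: nat.splits)
  qed
  then show ?case by blast
next
  case (Suc d)
  then obtain s where s: "s \<in> S" by (metis card.empty ex_in_conv not_less_zero)
  define T where "T = S - {s}"
  have T: "finite T" "d < card T" using Suc.prems s by (simp_all add: T_def)
  then have "T \<noteq> {}" by auto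
  define m where "m = Min ((\<lambda>x. \<bar>x - s\<bar>) ` T)"
  have m: "m > 0" "\<And>x. x \<in> T \<Longrightarrow> m \<le> \<bar>x - s\<bar>"
    using T(1) \<open>T \<noteq> {}\<close> by (auto simp: m_def T_def)
  obtain B where B: "\<And>p i. degree p \<le> d \<Longrightarrow> (\<forall>x\<in>T. \<bar>poly p x\<bar> \<le> 2 * M / m) \<Longrightarrow> \<bar>coeff p i\<bar> \<le> B"
    using Suc.IH[OF T, of "2 * M / m"] by blast
  have "\<bar>coeff p i\<bar> \<le> \<bar>s\<bar> * B + B + M" if p: "degree p \<le> Suc d" "\<forall>x\<in>S. \<bar>poly p x\<bar> \<le> M" for p i
  proof -
    have "poly (p - [:poly p s:]) s = 0" by simp
    then obtain r where r: "p - [:poly p s:] = [:-s, 1:] * r"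
      unfolding poly_eq_0_iff_dvd by (elim dvdE)
    have dr: "degree r \<le> d"
    proof (cases "r = 0")
      case False
      then have "degree ([:-s, 1:] * r) = Suc (degree r)" by (subst degree_mult_eq) simp_all
      moreover have "degree (p - [:poly p s:]) \<le> Suc d" using p(1) by (intro degree_diff_le) auto
      ultimately show ?thesis unfolding r by simp
    qed simp
    have bM: "\<bar>poly p s\<bar> \<le> M" using p(2) s by blast
    have "\<bar>poly r x\<bar> \<le> 2 * M / m" if x: "x \<in> T" for x
    proof -
      have "poly p x - poly p s = (x - s) * poly r x"
        using arg_cong[OF r, of "\<lambda>f. poly f x"] by (simp add: algebra_simps)
      moreover have "\<bar>poly p x\<bar> \<le> M" using p(2) x by (simp add: T_def)
      ultimately have "\<bar>x - s\<bar> * \<bar>poly r x\<bar> \<le> 2 * M"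
        using bM by (simp flip: abs_mult)
      moreover have "m * \<bar>poly r x\<bar> \<le> \<bar>x - s\<bar> * \<bar>poly r x\<bar>"
        using m(2)[OF x] by (intro mult_right_mono) auto
      ultimately show ?thesis using m(1) by (simp add: pos_le_divide_eq mult.commute)
    qed
    then have cr: "\<bar>coeff r j\<bar> \<le> B" for j using B dr by blast
    have "B \<ge> 0" using cr[of 0] by linarith
    have "p = [:-s, 1:] * r + [:poly p s:]" using r by (simp add: diff_eq_eq)
    then have "coeff p i = coeff ([:-s, 1:] * r + [:poly p s:]) i" by simp
    also have "\<dots> = - s * coeff r i + coeff (pCons 0 r) i + coeff [:poly p s:] i" by simp
    finally have "\<bar>coeff p i\<bar> \<le> \<bar>s * coeff r i\<bar> + \<bar>coeff (pCons 0 r) i\<bar> + \<bar>coeff [:poly p s:] i\<bar>"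
      by linarith
    moreover have "\<bar>s * coeff r i\<bar> \<le> \<bar>s\<bar> * B" using cr by (simp add: abs_mult mult_left_mono)
    moreover have "\<bar>coeff (pCons 0 r) i\<bar> \<le> B" using cr \<open>B \<ge> 0\<close> by (cases i) auto
    moreover have "\<bar>coeff [:poly p s:] i\<bar> \<le> M" using bM by (cases i) auto
    ultimately show ?thesis by linarith
  qed
  then show ?case by blast
qed

lemma infinite_negative_set:
  fixes q :: "real poly"
  assumes "poly q s < 0"
  shows "infinite {x. poly q x < 0}"
proof -
  have "(poly q \<longlongrightarrow> poly q s) (at s)"
    by (rule isContD[unfolded isCont_def]) (simp add: isCont_def[symmetric])
  then have "eventually (\<lambda>x. poly q x < 0) (at s)"
    using assms order_tendstoD(2) by blast
  then have "eventually (\<lambda>x. poly q x < 0) (at_right s)" by (simp add: eventually_at_split)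
  then obtain u where "u > s" "\<And>x. s < x \<Longrightarrow> x < u \<Longrightarrow> poly q x < 0"
    unfolding eventually_at_right_field by blast
  then have "{s<..<u} \<subseteq> {x. poly q x < 0}" by auto
  moreover have "infinite {s<..<u}" using \<open>u > s\<close> by (rule infinite_Ioo)
  ultimately show ?thesis using infinite_super by blast
qed

lemma poly_altdef_le:
  fixes p :: "'a::comm_semiring_1 poly"
  assumes "degree p \<le> d"
  shows "poly p x = (\<Sum>l\<le>d. coeff p l * x ^ l)"
proof -
  have "(\<Sum>l\<le>d. coeff p l * x ^ l) = (\<Sum>l\<le>degree p. coeff p l * x ^ l)"
    using assms by (intro sum.mono_neutral_right) (auto simp: coeff_eq_0)
  then show ?thesis using poly_altdef[of p x] by (simp only:)
qed

text \<open>Where q < 0 every summand of A is a sum of two nonnegative terms, so no cancellation can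
  hide large coefficients: the convergent values of A bound all c and e there. Taking d + 1 such
  points bounds the coefficients, and a subsequence along which all of them converge yields the
  representation of the limit.\<close>

lemma curve_sos_closed:
  fixes q :: "real poly" and A B :: "nat \<Rightarrow> real poly"
  assumes "poly q s < 0"
    and sos: "\<And>j. curve_sos q r d (A j) (B j)"
    and A: "\<And>x. (\<lambda>j. poly (A j) x) \<longlonglongrightarrow> poly a x"
    and B: "\<And>x. (\<lambda>j. poly (B j) x) \<longlonglongrightarrow> poly b x"
  shows "curve_sos q r d a b"
proof -
  have "\<forall>j. \<exists>c e :: nat \<Rightarrow> real poly. (\<forall>i<r. degree (c i) \<le> d \<and> degree (e i) \<le> d - 2) \<and>
     A j = (\<Sum>i<r. (c i)\<^sup>2 - q * (e i)\<^sup>2) \<and> B j = (\<Sum>i<r. 2 * c i * e i)"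
    using sos unfolding curve_sos_def by blast
  then obtain c e :: "nat \<Rightarrow> nat \<Rightarrow> real poly" where
    ce: "\<And>j i. i < r \<Longrightarrow> degree (c j i) \<le> d" "\<And>j i. i < r \<Longrightarrow> degree (e j i) \<le> d - 2"
      "\<And>j. A j = (\<Sum>i<r. (c j i)\<^sup>2 - q * (e j i)\<^sup>2)" "\<And>j. B j = (\<Sum>i<r. 2 * c j i * e j i)"
    unfolding choice_iff by blast
  obtain S where S: "finite S" "card S = Suc d" "S \<subseteq> {x. poly q x < 0}"
    using infinite_arbitrarily_large[OF infinite_negative_set[OF assms(1)]] by blast
  have "\<forall>x\<in>S. \<exists>M\<ge>0. \<forall>j i. i < r \<longrightarrow> \<bar>poly (c j i) x\<bar> \<le> M \<and> \<bar>poly (e j i) x\<bar> \<le> M"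
  proof
    fix x assume "x \<in> S"
    then have qx: "poly q x < 0" using S(3) by auto
    have "convergent (\<lambda>j. poly (A j) x)" using A by (auto simp: convergent_def)
    then have "Bseq (\<lambda>j. poly (A j) x)" by (rule convergent_imp_Bseq)
    then obtain K where K: "K > 0" "\<And>j. \<bar>poly (A j) x\<bar> \<le> K" by (auto elim: BseqE)
    \<comment> \<open>This covers both estimates below, c^2 \<le> K and e^2 \<le> K / (-q), by way
      of |t| \<le> 1 + t^2.\<close>
    define M where "M = 1 + K + K / (- poly q x)"
    have "K / (- poly q x) \<ge> 0" using K(1) qx by (intro divide_nonneg_pos) auto
    then have "M \<ge> 0" using K(1) by (simp add: M_def)
    have "\<bar>poly (c j i) x\<bar> \<le> M \<and> \<bar>poly (e j i) x\<bar> \<le> M" if i: "i < r" for j i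
    proof -
      have lin: "\<bar>t\<bar> \<le> 1 + t\<^sup>2" for t :: real
      proof -
        have "0 \<le> (1 - \<bar>t\<bar>)\<^sup>2" "0 \<le> t\<^sup>2" by simp_all
        then show ?thesis by (simp add: power2_diff)
      qed
      have nn: "(poly (c j l) x)\<^sup>2 - poly q x * (poly (e j l) x)\<^sup>2 \<ge> 0" for l
        using qx by (simp add: mult_nonpos_nonneg le_diff_eq order.trans[OF _ zero_le_power2])
      have "(poly (c j i) x)\<^sup>2 - poly q x * (poly (e j i) x)\<^sup>2
          \<le> (\<Sum>i<r. (poly (c j i) x)\<^sup>2 - poly q x * (poly (e j i) x)\<^sup>2)"
        using i nn by (intro member_le_sum) auto
      also have "\<dots> = poly (A j) x" by (simp add: ce(3) poly_sum)
      also have "\<dots> \<le> K" using K(2)[of j] by linarith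
      finally have le: "(poly (c j i) x)\<^sup>2 + (- poly q x) * (poly (e j i) x)\<^sup>2 \<le> K" by simp
      moreover have "(- poly q x) * (poly (e j i) x)\<^sup>2 \<ge> 0" using qx by (intro mult_nonneg_nonneg) auto
      ultimately have "(poly (c j i) x)\<^sup>2 \<le> K" by linarith
      have "(- poly q x) * (poly (e j i) x)\<^sup>2 \<le> K" using le zero_le_power2[of "poly (c j i) x"] by linarith
      then have "(poly (e j i) x)\<^sup>2 \<le> K / (- poly q x)" using qx by (subst pos_le_divide_eq) (simp_all add: mult.commute)
      with \<open>(poly (c j i) x)\<^sup>2 \<le> K\<close> show ?thesis
        using lin[of "poly (c j i) x"] lin[of "poly (e j i) x"] K(1) \<open>K / (- poly q x) \<ge> 0\<close>
        unfolding M_def by linarith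
    qed
    with \<open>M \<ge> 0\<close> show "\<exists>M\<ge>0. \<forall>j i. i < r \<longrightarrow> \<bar>poly (c j i) x\<bar> \<le> M \<and> \<bar>poly (e j i) x\<bar> \<le> M"
      by blast
  qed
  then obtain M where M: "\<And>x. x \<in> S \<Longrightarrow> M x \<ge> 0"
    "\<And>x j i. x \<in> S \<Longrightarrow> i < r \<Longrightarrow> \<bar>poly (c j i) x\<bar> \<le> M x \<and> \<bar>poly (e j i) x\<bar> \<le> M x"
    unfolding bchoice_iff by blast
  have Mx: "M x \<le> sum M S" if "x \<in> S" for x using that M(1) S(1) by (intro member_le_sum) auto
  obtain K where K: "\<And>p i. degree p \<le> d \<Longrightarrow> (\<forall>x\<in>S. \<bar>poly p x\<bar> \<le> sum M S) \<Longrightarrow> \<bar>coeff p i\<bar> \<le> K"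
    using poly_coeff_bounded_by_values[OF S(1), of d "sum M S"] S(2) by auto
  have Kc: "\<bar>coeff (c j i) l\<bar> \<le> K" if i: "i < r" for j i l
  proof (rule K[OF ce(1)[OF i]], rule ballI)
    fix x assume x: "x \<in> S"
    show "\<bar>poly (c j i) x\<bar> \<le> sum M S" using M(2)[OF x i, of j] Mx[OF x] by linarith
  qed
  have Ke: "\<bar>coeff (e j i) l\<bar> \<le> K" if i: "i < r" for j i l
  proof (rule K, use ce(2)[OF i, of j] in linarith, rule ballI)
    fix x assume x: "x \<in> S"
    show "\<bar>poly (e j i) x\<bar> \<le> sum M S" using M(2)[OF x i, of j] Mx[OF x] by linarith
  qed
  define X where "X = (\<lambda>(t, i, l) j. coeff (if t then c j i else e j i) l)"
  have "\<exists>\<sigma>. strict_mono \<sigma> \<and> (\<forall>v\<in>UNIV \<times> {..<r} \<times> {..d}. convergent (\<lambda>n. X v (\<sigma> n)))"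
    by (rule bounded_family_convergent_subseq[where B = K]) (auto simp: X_def Kc Ke)
  then obtain \<sigma> where \<sigma>: "strict_mono \<sigma>"
    "\<And>v. v \<in> UNIV \<times> {..<r} \<times> {..d} \<Longrightarrow> convergent (\<lambda>n. X v (\<sigma> n))" by blast
  define L where "L v = lim (\<lambda>n. X v (\<sigma> n))" for v
  have L: "(\<lambda>n. X v (\<sigma> n)) \<longlonglongrightarrow> L v" if "v \<in> UNIV \<times> {..<r} \<times> {..d}" for v
    unfolding L_def using \<sigma>(2)[OF that] by (simp add: convergent_LIMSEQ_iff)
  define c' where "c' i = (\<Sum>l\<le>d. monom (L (True, i, l)) l)" for i
  define e' where "e' i = (\<Sum>l\<le>d - 2. monom (L (False, i, l)) l)" for i
  have c': "(\<lambda>n. poly (c (\<sigma> n) i) x) \<longlonglongrightarrow> poly (c' i) x" if i: "i < r" for i x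
  proof -
    have "(\<lambda>n. \<Sum>l\<le>d. coeff (c (\<sigma> n) i) l * x ^ l) \<longlonglongrightarrow> (\<Sum>l\<le>d. L (True, i, l) * x ^ l)"
    proof (intro tendsto_sum tendsto_mult tendsto_const)
      fix l assume "l \<in> {..d}"
      then show "(\<lambda>n. coeff (c (\<sigma> n) i) l) \<longlonglongrightarrow> L (True, i, l)"
        using L[of "(True, i, l)"] i by (simp add: X_def)
    qed
    then show ?thesis by (simp add: poly_altdef_le[OF ce(1)[OF i]] c'_def poly_sum poly_monom)
  qed
  have e': "(\<lambda>n. poly (e (\<sigma> n) i) x) \<longlonglongrightarrow> poly (e' i) x" if i: "i < r" for i x
  proof -
    have "(\<lambda>n. \<Sum>l\<le>d - 2. coeff (e (\<sigma> n) i) l * x ^ l) \<longlonglongrightarrow> (\<Sum>l\<le>d - 2. L (False, i, l) * x ^ l)"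
    proof (intro tendsto_sum tendsto_mult tendsto_const)
      fix l assume "l \<in> {..d - 2}"
      then show "(\<lambda>n. coeff (e (\<sigma> n) i) l) \<longlonglongrightarrow> L (False, i, l)"
        using L[of "(False, i, l)"] i by (simp add: X_def)
    qed
    then show ?thesis by (simp add: poly_altdef_le[OF ce(2)[OF i]] e'_def poly_sum poly_monom)
  qed
  have "poly a x = poly (\<Sum>i<r. (c' i)\<^sup>2 - q * (e' i)\<^sup>2) x" for x
  proof (rule LIMSEQ_unique)
    show "(\<lambda>n. poly (A (\<sigma> n)) x) \<longlonglongrightarrow> poly a x"
      using LIMSEQ_subseq_LIMSEQ[OF A \<sigma>(1)] by (simp add: o_def)
    show "(\<lambda>n. poly (A (\<sigma> n)) x) \<longlonglongrightarrow> poly (\<Sum>i<r. (c' i)\<^sup>2 - q * (e' i)\<^sup>2) x"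
      unfolding ce(3) poly_sum poly_diff poly_mult poly_power
      by (intro tendsto_intros c' e') auto
  qed
  moreover have "poly b x = poly (\<Sum>i<r. 2 * c' i * e' i) x" for x
  proof (rule LIMSEQ_unique)
    show "(\<lambda>n. poly (B (\<sigma> n)) x) \<longlonglongrightarrow> poly b x"
      using LIMSEQ_subseq_LIMSEQ[OF B \<sigma>(1)] by (simp add: o_def)
    show "(\<lambda>n. poly (B (\<sigma> n)) x) \<longlonglongrightarrow> poly (\<Sum>i<r. 2 * c' i * e' i) x"
      unfolding ce(4) poly_sum poly_mult
      by (intro tendsto_intros c' e') auto
  qed
  ultimately have "a = (\<Sum>i<r. (c' i)\<^sup>2 - q * (e' i)\<^sup>2)" "b = (\<Sum>i<r. 2 * c' i * e' i)"
    by (auto intro: poly_eq_from_punctured)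
  moreover have "degree (c' i) \<le> d" "degree (e' i) \<le> d - 2" for i
    unfolding c'_def e'_def by (auto intro!: degree_sum_le intro: order.trans[OF degree_monom_le])
  ultimately show ?thesis unfolding curve_sos_def by (intro exI[of _ c'] exI[of _ e']) simp
qed

section \<open>Dividing by a linear factor\<close>

text \<open>The Hermitian square of U + V y is the sum of the squares of its real part and its
  imaginary part, taken coefficientwise. This doubles the number of squares and leaves the degree
  bounds intact.\<close>

lemma curve_sos_of_hermitian_squares:
  fixes U V :: "nat \<Rightarrow> complex poly"
  assumes a: "\<And>x. poly a x = (\<Sum>i<r. (cmod (poly (U i) (of_real x)))\<^sup>2 - poly q x * (cmod (poly (V i) (of_real x)))\<^sup>2)"
    and b: "\<And>x. poly b x = (\<Sum>i<r. 2 * Re (poly (U i) (of_real x) * cnj (poly (V i) (of_real x))))"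
    and deg: "\<And>i. i < r \<Longrightarrow> degree (U i) \<le> d" "\<And>i. i < r \<Longrightarrow> degree (V i) \<le> d - 2"
  shows "curve_sos q (r + r) d a b"
proof -
  define c where "c i = (if i < r then map_poly Re (U i) else map_poly Im (U (i - r)))" for i
  define e where "e i = (if i < r then map_poly Re (V i) else map_poly Im (V (i - r)))" for i
  have split: "(\<Sum>i<r+n. h i) = (\<Sum>i<r. h i) + (\<Sum>i<n. h (r + i))" for n and h :: "nat \<Rightarrow> real"
    by (induction n) (simp_all add: add.assoc)
  have "poly a x = poly (\<Sum>i<r+r. (c i)\<^sup>2 - q * (e i)\<^sup>2) x" for x
    unfolding a poly_sum split sum.distrib[symmetric]
    by (intro sum.cong refl)
      (simp add: c_def e_def poly_map_poly_Re poly_map_poly_Im cmod_power2 algebra_simps)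
  moreover have "poly b x = poly (\<Sum>i<r+r. 2 * c i * e i) x" for x
    unfolding b poly_sum split sum.distrib[symmetric]
    by (intro sum.cong refl)
      (simp add: c_def e_def poly_map_poly_Re poly_map_poly_Im algebra_simps)
  ultimately have "a = (\<Sum>i<r+r. (c i)\<^sup>2 - q * (e i)\<^sup>2)" "b = (\<Sum>i<r+r. 2 * c i * e i)"
    by (auto intro: poly_eq_from_punctured)
  moreover have "degree (c i) \<le> d \<and> degree (e i) \<le> d - 2" if "i < r + r" for i
  proof (cases "i < r")
    case True
    then show ?thesis
      using deg[OF True] degree_map_poly_Re_le[of "U i"] degree_map_poly_Re_le[of "V i"]
      by (simp add: c_def e_def)
  next
    case False
    then have "i - r < r" using that by simp
    then show ?thesis
      using False deg[of "i - r"] degree_map_poly_Im_le[of "U (i - r)"] degree_map_poly_Im_le[of "V (i - r)"]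
      by (simp add: c_def e_def)
  qed
  ultimately show ?thesis unfolding curve_sos_def by (intro exI[of _ c] exI[of _ e]) simp
qed

text \<open>The sum u^2 + v^2 is invariant under rotation of the pair (u, v), and a constant
  rotation can turn its value at \<open>x0\<close> onto the nonnegative first axis.\<close>

lemma two_squares_rotated:
  fixes p :: "real poly"
  assumes "\<And>x. poly p x \<ge> 0"
  obtains u v where "p = u\<^sup>2 + v\<^sup>2" "2 * degree u \<le> degree p" "2 * degree v \<le> degree p"
    "poly u x0 = sqrt (poly p x0)" "poly v x0 = 0"
proof -
  obtain u v where uv: "p = u\<^sup>2 + v\<^sup>2" "2 * degree u \<le> degree p" "2 * degree v \<le> degree p"
    using nonneg_poly_two_squares[of p] assms by blast
  have p0: "poly p x0 = (poly u x0)\<^sup>2 + (poly v x0)\<^sup>2" by (simp add: uv(1))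
  show thesis
  proof (cases "poly p x0 = 0")
    case True
    then have "poly u x0 = 0" "poly v x0 = 0" using p0 by (simp_all add: sum_power2_eq_zero_iff)
    with True uv that show thesis by simp
  next
    case False
    define s where "s = sqrt (poly p x0)"
    have s: "s\<^sup>2 = poly p x0" "s \<noteq> 0" using assms[of x0] False by (simp_all add: s_def)
    define c e where "c = poly u x0 / s" and "e = poly v x0 / s"
    have ce: "c\<^sup>2 + e\<^sup>2 = 1"
      using s(2)
      by (simp only: c_def e_def power_divide add_divide_distrib[symmetric] p0[symmetric] s(1)[symmetric]) simp
    have "p = (smult c u + smult e v)\<^sup>2 + (smult c v - smult e u)\<^sup>2"
    proof (rule poly_eq_from_punctured)
      fix x :: real
      have "poly p x = (c\<^sup>2 + e\<^sup>2) * ((poly u x)\<^sup>2 + (poly v x)\<^sup>2)" by (simp add: ce uv(1))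
      then show "poly p x = poly ((smult c u + smult e v)\<^sup>2 + (smult c v - smult e u)\<^sup>2) x"
        by (simp add: power2_eq_square algebra_simps)
    qed
    moreover have "2 * degree (smult c u + smult e v) \<le> degree p" "2 * degree (smult c v - smult e u) \<le> degree p"
      using uv degree_smult_le[of c u] degree_smult_le[of e v] degree_smult_le[of c v] degree_smult_le[of e u]
        degree_add_le_max[of "smult c u" "smult e v"] degree_diff_le_max[of "smult c v" "smult e u"] by linarith+
    moreover have "poly (smult c u + smult e v) x0 = s"
      using s p0 by (simp add: c_def e_def field_simps power2_eq_square)
    moreover have "poly (smult c v - smult e u) x0 = 0"
      by (simp add: c_def e_def)
    ultimately show thesis using that by (simp add: s_def)
  qed
qed

text \<open>Multiplicativity of the Hermitian square: with y^2 = -q, the product (\<alpha> + \<beta>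
  y)(c + i \<sigma> d y) has the two displayed components, and the Hermitian square of the second
  factor is c^2 - q d^2, free of y. The two equations compare the part free of y and the coefficient
  of y.\<close>

lemma norm_form_mult:
  fixes \<alpha> \<beta> :: complex and c d q \<sigma> :: real
  assumes "\<sigma>\<^sup>2 = 1"
  shows "(cmod (\<alpha> * c - \<i> * \<sigma> * q * \<beta> * d))\<^sup>2 - q * (cmod (\<i> * \<sigma> * \<alpha> * d + \<beta> * c))\<^sup>2
      = (c\<^sup>2 - q * d\<^sup>2) * ((cmod \<alpha>)\<^sup>2 - q * (cmod \<beta>)\<^sup>2)"
    and "2 * Re ((\<alpha> * c - \<i> * \<sigma> * q * \<beta> * d) * cnj (\<i> * \<sigma> * \<alpha> * d + \<beta> * c))
      = (c\<^sup>2 - q * d\<^sup>2) * (2 * Re (\<alpha> * cnj \<beta>))"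
  using assms unfolding cmod_power2 by simp_all algebra+

text \<open>The hypotheses say that the Hermitian square of \<alpha> + \<beta> y vanishes over a
  point with q = t^2. The points there have y = i t or y = -i t, and the sign \<sigma> records that
  the factor itself vanishes at y = -i \<sigma> t.\<close>

lemma imaginary_ratio:
  fixes \<alpha> \<beta> :: complex and t :: real
  assumes "(cmod \<alpha>)\<^sup>2 = t\<^sup>2 * (cmod \<beta>)\<^sup>2" and "Re (\<alpha> * cnj \<beta>) = 0"
  obtains \<sigma> :: real where "\<sigma>\<^sup>2 = 1" "\<alpha> = \<i> * \<sigma> * t * \<beta>"
proof (cases "\<beta> = 0")
  case True
  with assms(1) that[of 1] show thesis by simp
next
  case False
  define y where "y = Im (\<alpha> * cnj \<beta>)"
  have ay: "\<alpha> * cnj \<beta> = \<i> * y" using assms(2) by (simp add: y_def complex_eq_iff)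
  have "y\<^sup>2 = (cmod (\<alpha> * cnj \<beta>))\<^sup>2" unfolding ay by (simp add: norm_mult)
  also have "\<dots> = (t * (cmod \<beta>)\<^sup>2)\<^sup>2"
    using assms(1) by (simp add: norm_mult power_mult_distrib)
  finally have "y = t * (cmod \<beta>)\<^sup>2 \<or> y = - (t * (cmod \<beta>)\<^sup>2)" by (simp add: power2_eq_iff)
  then obtain \<sigma> :: real where \<sigma>: "\<sigma>\<^sup>2 = 1" "y = \<sigma> * (t * (cmod \<beta>)\<^sup>2)"
    by (metis mult_1 mult_minus_left one_power2 power2_minus)
  have "\<alpha> * (\<beta> * cnj \<beta>) = (\<alpha> * cnj \<beta>) * \<beta>" by simp
  also have "\<dots> = \<i> * \<sigma> * t * \<beta> * (\<beta> * cnj \<beta>)"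
    unfolding ay \<sigma>(2) complex_norm_square[symmetric] by simp
  finally have "\<alpha> = \<i> * \<sigma> * t * \<beta>" using False by simp
  with \<sigma>(1) that show thesis by blast
qed

text \<open>
  If $h \overline{h} = f g$ with $g = \gamma (x - x_0)$, then $h$ vanishes at one of the two points
  $R, \overline{R}$ over $x_0$. Rotating a certificate $g = c_1^2 + c_2^2 + (d_1 y)^2 + (d_2 y)^2$ gives
  $g = |c_1 + i \sigma d_1 y|^2 + c_2^2 + (d_2 y)^2$ whose summands all vanish at the other point.
  Multiplied by $h$, each of them becomes divisible by $g$.
\<close>

lemma curve_sos_of_linear_multiple:
  fixes q a b g D :: "real poly" and \<alpha> \<beta> :: "complex poly"
  assumes q: "degree q = 4" and neg: "poly q s < 0" and k: "k \<ge> 2"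
    and d\<alpha>: "degree \<alpha> \<le> k" and d\<beta>: "degree \<beta> \<le> k - 2"
    and g: "g \<noteq> 0" "degree g \<le> 1"
    and X: "\<And>x. poly a x * poly g x =
       (cmod (poly \<alpha> (of_real x)))\<^sup>2 - poly q x * (cmod (poly \<beta> (of_real x)))\<^sup>2"
    and Y: "\<And>x. poly b x * poly g x = 2 * Re (poly \<alpha> (of_real x) * cnj (poly \<beta> (of_real x)))"
    and D: "\<And>x. poly D x \<ge> 0" "degree D \<le> 2 * e"
    and A: "\<And>x. poly (g + q * D) x \<ge> 0"
    and root: "\<And>x. degree g = 1 \<Longrightarrow> poly g x = 0 \<Longrightarrow> poly q x \<ge> 0"
  shows "curve_sos q 6 (k + e + 2) a b"
proof (cases "degree g = 0")
  case True
  then obtain \<gamma> where \<gamma>: "g = [:\<gamma>:]" by (metis degree_eq_zeroE)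
  have "\<gamma> \<ge> - poly q s * poly D s" using A[of s] by (simp add: \<gamma>)
  moreover have "- poly q s * poly D s \<ge> 0" using neg D(1) by (intro mult_nonneg_nonneg) auto
  ultimately have \<gamma>0: "\<gamma> > 0" using g(1) \<gamma> by (metis less_eq_real_def order.trans pCons_0_0)
  \<comment> \<open>For a positive constant g, rescaling h suffices. The two zero summands bring the
    count to three Hermitian squares, as in the linear case.\<close>
  define U where "U i = (if i = 0 then smult (of_real (1 / sqrt \<gamma>)) \<alpha> else 0)" for i :: nat
  define V where "V i = (if i = 0 then smult (of_real (1 / sqrt \<gamma>)) \<beta> else 0)" for i :: nat
  have s3: "(\<Sum>i<3. h i) = h 0 + h 1 + h 2" for h :: "nat \<Rightarrow> real"
    by (simp add: eval_nat_numeral)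
  have "curve_sos q (3 + 3) (k + e + 2) a b"
  proof (rule curve_sos_of_hermitian_squares)
    fix x
    have "poly a x = (poly a x * poly g x) / \<gamma>" using \<gamma>0 by (simp add: \<gamma>)
    then show "poly a x = (\<Sum>i<3. (cmod (poly (U i) (of_real x)))\<^sup>2 - poly q x * (cmod (poly (V i) (of_real x)))\<^sup>2)"
      using \<gamma>0 unfolding X
      by (simp add: U_def V_def s3 norm_mult norm_divide power_mult_distrib power_divide diff_divide_distrib)
  next
    fix x
    have "poly b x = (poly b x * poly g x) / \<gamma>" using \<gamma>0 by (simp add: \<gamma>)
    then show "poly b x = (\<Sum>i<3. 2 * Re (poly (U i) (of_real x) * cnj (poly (V i) (of_real x))))"
      using \<gamma>0 unfolding Y
      by (simp add: U_def V_def s3 add_divide_distrib)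
  qed (use d\<alpha> d\<beta> in \<open>auto simp: U_def V_def intro: order.trans[OF degree_smult_le]\<close>)
  then show ?thesis by simp
next
  case False
  then have dg: "degree g = 1" using g(2) by simp
  define \<gamma> where "\<gamma> = coeff g 1"
  have \<gamma>: "\<gamma> \<noteq> 0" using dg g(1) leading_coeff_0_iff[of g] by (simp add: \<gamma>_def)
  define x0 where "x0 = - coeff g 0 / \<gamma>"
  have gx: "poly g x = \<gamma> * (x - x0)" for x
  proof -
    have "poly g x = coeff g 0 + coeff g 1 * x" using poly_altdef_le[of g 1 x] dg by simp
    also have "\<dots> = \<gamma> * (x - x0)"
      unfolding x0_def \<gamma>_def[symmetric] using \<gamma> by (simp add: distrib_left)
    finally show ?thesis .
  qed
  define t where "t = sqrt (poly q x0)"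
  have qx0: "poly q x0 = t\<^sup>2" using root[OF dg, of x0] by (simp add: t_def gx)
  have t0: "t \<ge> 0" using root[OF dg, of x0] by (simp add: t_def gx)
  obtain d1 d2 where d: "D = d1\<^sup>2 + d2\<^sup>2" "2 * degree d1 \<le> degree D" "2 * degree d2 \<le> degree D"
    "poly d1 x0 = sqrt (poly D x0)" "poly d2 x0 = 0"
    by (rule two_squares_rotated[of D x0, OF D(1)])
  obtain c1 c2 where c: "g + q * D = c1\<^sup>2 + c2\<^sup>2" "2 * degree c1 \<le> degree (g + q * D)" "2 * degree c2 \<le> degree (g + q * D)"
    "poly c1 x0 = sqrt (poly (g + q * D) x0)" "poly c2 x0 = 0"
    by (rule two_squares_rotated[of "g + q * D" x0, OF A])
  \<comment> \<open>Over \<open>x0\<close> the polynomial g + q D equals t^2 D. Both rotations chose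
    the nonnegative root, so no sign ambiguity remains.\<close>
  have c10: "poly c1 x0 = t * poly d1 x0"
    unfolding c(4) d(4) using t0 by (simp add: gx qx0 real_sqrt_mult)
  have dd: "degree d1 \<le> e" "degree d2 \<le> e" using d D(2) by linarith+
  have "degree (g + q * D) \<le> 2 * e + 4"
    using degree_mult_le[of q D] q D(2) dg by (intro degree_add_le) auto
  then have dc: "degree c1 \<le> e + 2" "degree c2 \<le> e + 2" using c by linarith+
  define \<alpha>0 \<beta>0 where "\<alpha>0 = poly \<alpha> (of_real x0)" and "\<beta>0 = poly \<beta> (of_real x0)"
  have "(cmod \<alpha>0)\<^sup>2 = t\<^sup>2 * (cmod \<beta>0)\<^sup>2" "Re (\<alpha>0 * cnj \<beta>0) = 0"
    using X[of x0] Y[of x0] by (simp_all add: gx qx0 \<alpha>0_def \<beta>0_def)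
  then obtain \<sigma> :: real where \<sigma>: "\<sigma>\<^sup>2 = 1" "\<alpha>0 = \<i> * \<sigma> * t * \<beta>0"
    by (rule imaginary_ratio)
  \<comment> \<open>P i + Q i y is h times one of c1 + i \<sigma> d1 y, c2 and d2 y. The factor h
    vanishes at y = -i \<sigma> t over \<open>x0\<close> and c1 + i \<sigma> d1 y at y = i \<sigma>
    t, while c2 and d2 vanish at \<open>x0\<close> outright. Hence P i and Q i both acquire the root
    \<open>x0\<close>.\<close>
  define P :: "nat \<Rightarrow> complex poly" where
    "P i = (if i = 0 then \<alpha> * cpoly c1 - smult (\<i> * \<sigma>) (cpoly q * \<beta> * cpoly d1)
            else if i = 1 then \<alpha> * cpoly c2 else - (cpoly q * \<beta> * cpoly d2))" for i
  define Q :: "nat \<Rightarrow> complex poly" where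
    "Q i = (if i = 0 then smult (\<i> * \<sigma>) (\<alpha> * cpoly d1) + \<beta> * cpoly c1
            else if i = 1 then \<beta> * cpoly c2 else \<alpha> * cpoly d2)" for i
  have \<sigma>c: "complex_of_real \<sigma> * complex_of_real \<sigma> = 1"
    using \<sigma>(1) by (metis of_real_1 of_real_mult power2_eq_square)
  have P0: "poly (P i) (of_real x0) = 0" for i
    unfolding P_def
    by (simp add: poly_cpoly_of_real c10 c(5) d(5) qx0 \<alpha>0_def[symmetric] \<beta>0_def[symmetric] \<sigma>(2))
       (simp add: power2_eq_square)
  have Q0: "poly (Q i) (of_real x0) = 0" for i
  proof -
    have "\<i> * \<sigma> * (\<i> * \<sigma> * t * \<beta>0 * w) + \<beta>0 * (t * w) = 0" for w :: complex
    proof -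
      have "\<i> * \<sigma> * (\<i> * \<sigma> * t * \<beta>0 * w) = (\<i> * \<i>) * (\<sigma> * \<sigma>) * (t * \<beta>0 * w)"
        by (simp only: of_real_mult mult_ac)
      then show ?thesis by (simp add: \<sigma>c)
    qed
    then show ?thesis
      using \<sigma>(2) by (simp add: Q_def poly_cpoly_of_real c10 c(5) d(5) \<alpha>0_def[symmetric] \<beta>0_def[symmetric])
  qed
  have "\<exists>p. P i = [:- of_real x0, 1:] * p" for i
    using P0[of i] unfolding poly_eq_0_iff_dvd dvd_def .
  then have "\<forall>i. \<exists>p. P i = [:- of_real x0, 1:] * p" by (rule allI)
  then obtain P' where P': "\<And>i. P i = [:- of_real x0, 1:] * P' i"
    unfolding choice_iff by blast
  have "\<exists>p. Q i = [:- of_real x0, 1:] * p" for i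
    using Q0[of i] unfolding poly_eq_0_iff_dvd dvd_def .
  then have "\<forall>i. \<exists>p. Q i = [:- of_real x0, 1:] * p" by (rule allI)
  then obtain Q' where Q': "\<And>i. Q i = [:- of_real x0, 1:] * Q' i"
    unfolding choice_iff by blast
  define U where "U i = smult (of_real (1 / \<gamma>)) (P' i)" for i
  define V where "V i = smult (of_real (1 / \<gamma>)) (Q' i)" for i
  have U: "poly (U i) (of_real x) = poly (P i) (of_real x) / of_real (poly g x)"
    and V: "poly (V i) (of_real x) = poly (Q i) (of_real x) / of_real (poly g x)" if "x \<noteq> x0" for i x
  proof -
    have nz: "complex_of_real x - complex_of_real x0 \<noteq> 0" using that by simp
    have "poly (P i) (of_real x) = (of_real x - of_real x0) * poly (P' i) (of_real x)"
      "poly (Q i) (of_real x) = (of_real x - of_real x0) * poly (Q' i) (of_real x)"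
      unfolding P' Q' by (simp_all add: algebra_simps)
    then show "poly (U i) (of_real x) = poly (P i) (of_real x) / of_real (poly g x)"
      "poly (V i) (of_real x) = poly (Q i) (of_real x) / of_real (poly g x)"
      using nz \<gamma> by (simp_all add: U_def V_def gx)
  qed
  \<comment> \<open>The three factors have Hermitian squares adding up to g, and that of h is f g.
    The total is f g^2, from which dividing P and Q by g removes g^2.\<close>
  have PQ: "(\<Sum>i<3. (cmod (poly (P i) (of_real x)))\<^sup>2 - poly q x * (cmod (poly (Q i) (of_real x)))\<^sup>2)
      = (poly g x)\<^sup>2 * poly a x"
    "(\<Sum>i<3. 2 * Re (poly (P i) (of_real x) * cnj (poly (Q i) (of_real x)))) = (poly g x)\<^sup>2 * poly b x" for x
  proof -
    define \<alpha>x \<beta>x where "\<alpha>x = poly \<alpha> (of_real x)" and "\<beta>x = poly \<beta> (of_real x)"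
    define c1x c2x d1x d2x qx where "c1x = poly c1 x" and "c2x = poly c2 x"
      and "d1x = poly d1 x" and "d2x = poly d2 x" and "qx = poly q x"
    have g': "poly g x = (c1x\<^sup>2 - qx * d1x\<^sup>2) + c2x\<^sup>2 - qx * d2x\<^sup>2"
      using arg_cong[OF c(1), of "\<lambda>p. poly p x"]
      by (simp add: d(1) c1x_def c2x_def d1x_def d2x_def qx_def algebra_simps)
    have X': "(cmod \<alpha>x)\<^sup>2 - qx * (cmod \<beta>x)\<^sup>2 = poly a x * poly g x"
      and Y': "2 * Re (\<alpha>x * cnj \<beta>x) = poly b x * poly g x"
      using X[of x] Y[of x] by (simp_all add: \<alpha>x_def \<beta>x_def qx_def)
    note defs = \<alpha>x_def[symmetric] \<beta>x_def[symmetric] c1x_def[symmetric] c2x_def[symmetric]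
      d1x_def[symmetric] d2x_def[symmetric] qx_def[symmetric]
    have P: "poly (P 0) (of_real x) = \<alpha>x * c1x - \<i> * \<sigma> * qx * \<beta>x * d1x"
      "poly (P 1) (of_real x) = \<alpha>x * c2x" "poly (P 2) (of_real x) = - (qx * \<beta>x * d2x)"
      by (simp_all add: P_def poly_cpoly_of_real defs mult.assoc)
    have Q: "poly (Q 0) (of_real x) = \<i> * \<sigma> * \<alpha>x * d1x + \<beta>x * c1x"
      "poly (Q 1) (of_real x) = \<beta>x * c2x" "poly (Q 2) (of_real x) = \<alpha>x * d2x"
      by (simp_all add: Q_def poly_cpoly_of_real defs mult.assoc)
    have s3: "(\<Sum>i<3. h i) = h 0 + h 1 + h 2" for h :: "nat \<Rightarrow> real"
      by (simp add: eval_nat_numeral)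
    have "(cmod (\<alpha>x * c2x))\<^sup>2 - qx * (cmod (\<beta>x * c2x))\<^sup>2 = c2x\<^sup>2 * ((cmod \<alpha>x)\<^sup>2 - qx * (cmod \<beta>x)\<^sup>2)"
      "(cmod (- (qx * \<beta>x * d2x)))\<^sup>2 - qx * (cmod (\<alpha>x * d2x))\<^sup>2 = - qx * d2x\<^sup>2 * ((cmod \<alpha>x)\<^sup>2 - qx * (cmod \<beta>x)\<^sup>2)"
      by (simp_all add: norm_mult power_mult_distrib algebra_simps power2_eq_square[of qx])
    note E1 = this
    show "(\<Sum>i<3. (cmod (poly (P i) (of_real x)))\<^sup>2 - poly q x * (cmod (poly (Q i) (of_real x)))\<^sup>2)
      = (poly g x)\<^sup>2 * poly a x"
      unfolding s3 P Q qx_def[symmetric] norm_form_mult(1)[OF \<sigma>(1)] E1 X' using g' by algebra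
    have "2 * Re ((\<alpha>x * c2x) * cnj (\<beta>x * c2x)) = c2x\<^sup>2 * (2 * Re (\<alpha>x * cnj \<beta>x))"
      "2 * Re (- (qx * \<beta>x * d2x) * cnj (\<alpha>x * d2x)) = - qx * d2x\<^sup>2 * (2 * Re (\<alpha>x * cnj \<beta>x))"
      by (simp_all add: power2_eq_square algebra_simps)
    note E2 = this
    show "(\<Sum>i<3. 2 * Re (poly (P i) (of_real x) * cnj (poly (Q i) (of_real x)))) = (poly g x)\<^sup>2 * poly b x"
      unfolding s3 P Q norm_form_mult(2)[OF \<sigma>(1)] E2 Y' using g' by algebra
  qed
  have "curve_sos q (3 + 3) (k + e + 2) a b"
  proof (rule curve_sos_of_hermitian_squares)
    fix x
    define p1 where "p1 = (\<Sum>i<3. (map_poly Re (U i))\<^sup>2 + (map_poly Im (U i))\<^sup>2 - q * ((map_poly Re (V i))\<^sup>2 + (map_poly Im (V i))\<^sup>2))"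
    have p1: "poly p1 x = (\<Sum>i<3. (cmod (poly (U i) (of_real x)))\<^sup>2 - poly q x * (cmod (poly (V i) (of_real x)))\<^sup>2)" for x
      by (simp add: p1_def poly_sum poly_map_poly_Re poly_map_poly_Im cmod_power2)
    \<comment> \<open>Division by the value of g is legitimate only off \<open>x0\<close>; the
      equality of polynomials carries the identity over to \<open>x0\<close>.\<close>
    have "a = p1"
    proof (rule poly_eq_from_punctured)
      fix x assume x: "x \<noteq> x0"
      then have "poly g x \<noteq> 0" using \<gamma> by (simp add: gx)
      then have "poly a x = (poly g x)\<^sup>2 * poly a x / (poly g x)\<^sup>2" by simp
      also have "\<dots> = poly p1 x"
        unfolding p1 PQ(1)[symmetric] U[OF x] V[OF x] sum_divide_distrib
        by (intro sum.cong refl) (simp add: norm_divide power_divide diff_divide_distrib)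
      finally show "poly a x = poly p1 x" .
    qed
    then show "poly a x = (\<Sum>i<3. (cmod (poly (U i) (of_real x)))\<^sup>2 - poly q x * (cmod (poly (V i) (of_real x)))\<^sup>2)"
      using p1 by simp
  next
    fix x
    define p2 where "p2 = (\<Sum>i<3. smult 2 (map_poly Re (U i) * map_poly Re (V i) + map_poly Im (U i) * map_poly Im (V i)))"
    have p2: "poly p2 x = (\<Sum>i<3. 2 * Re (poly (U i) (of_real x) * cnj (poly (V i) (of_real x))))" for x
      by (simp add: p2_def poly_sum poly_map_poly_Re poly_map_poly_Im)
    have "b = p2"
    proof (rule poly_eq_from_punctured)
      fix x assume x: "x \<noteq> x0"
      then have "poly g x \<noteq> 0" using \<gamma> by (simp add: gx)
      then have "poly b x = (poly g x)\<^sup>2 * poly b x / (poly g x)\<^sup>2" by simp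
      also have "\<dots> = poly p2 x"
        unfolding p2 PQ(2)[symmetric] U[OF x] V[OF x] sum_divide_distrib
        by (intro sum.cong refl) (simp add: Re_divide_of_real power2_eq_square add_divide_distrib)
      finally show "poly b x = poly p2 x" .
    qed
    then show "poly b x = (\<Sum>i<3. 2 * Re (poly (U i) (of_real x) * cnj (poly (V i) (of_real x))))"
      using p2 by simp
  next
    fix i :: nat
    have dm: "degree (p * r) \<le> i + j" if "degree p \<le> i" "degree r \<le> j" for p r :: "complex poly" and i j
      using that degree_mult_le[of p r] by linarith
    have quot: "degree r \<le> degree p" if "p = [:- of_real x0, 1:] * r" for p r :: "complex poly"
      using that by (cases "r = 0") (simp_all add: degree_mult_eq del: mult_pCons_left)
    note ds = degree_cpoly[of q, unfolded q] dc[folded degree_cpoly] dd[folded degree_cpoly]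
    \<comment> \<open>The two kinds of product balance: k + (e + 2) from \<alpha> c1, and 4 + (k -
      2) + e from q \<beta> d1.\<close>
    have "degree (P i) \<le> k + e + 2"
      using dm[OF d\<alpha> ds(2)] dm[OF d\<alpha> ds(3)]
        dm[OF dm[OF eq_refl[OF ds(1)] d\<beta>] ds(4)] dm[OF dm[OF eq_refl[OF ds(1)] d\<beta>] ds(5)] k
      by (auto simp: P_def intro!: degree_diff_le order.trans[OF degree_smult_le])
    then show "degree (U i) \<le> k + e + 2"
      unfolding U_def using quot[OF P'[of i]] degree_smult_le[of "of_real (1 / \<gamma>)" "P' i"] by linarith
    have "degree (Q i) \<le> k + e"
      using dm[OF d\<alpha> ds(4)] dm[OF d\<alpha> ds(5)] dm[OF d\<beta> ds(2)] dm[OF d\<beta> ds(3)] k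
      by (auto simp: Q_def intro!: degree_add_le order.trans[OF degree_smult_le])
    then show "degree (V i) \<le> k + e + 2 - 2"
      unfolding V_def using quot[OF Q'[of i]] degree_smult_le[of "of_real (1 / \<gamma>)" "Q' i"] by linarith
  qed
  then show ?thesis by simp
qed

section \<open>Linear polynomials nonnegative where q \<le> 0, and strictly positive
  elements\<close>

lemma pcompose_line: "poly (p \<circ>\<^sub>p [:u, v:]) z = poly p (u + z * v)"
  by (simp add: poly_pcompose)

lemma positive_outside_interval:
  fixes q :: "real poly"
  assumes "even (degree q)" and "lead_coeff q > 0"
  obtains M where "\<And>x. \<bar>x\<bar> \<ge> M \<Longrightarrow> poly q x > 0"
proof -
  obtain n where n: "\<forall>x\<ge>n. lead_coeff q \<le> poly q x"
    using poly_pinfty_gt_lc[OF assms(2)] by blast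
  define q' where "q' = q \<circ>\<^sub>p [:0, -1:]"
  have q': "poly q' x = poly q (- x)" for x by (simp add: q'_def poly_pcompose)
  have lc: "lead_coeff q' = lead_coeff q"
    unfolding q'_def using assms(1) by (subst lead_coeff_comp) auto
  with assms(2) have "lead_coeff q' > 0" by simp
  from poly_pinfty_gt_lc[OF this] obtain n' where n': "\<forall>x\<ge>n'. lead_coeff q' \<le> poly q' x" by blast
  show thesis
  proof (rule that[of "max n n'"])
    fix x assume x: "\<bar>x\<bar> \<ge> max n n'"
    show "poly q x > 0"
    proof (cases "x \<ge> 0")
      case True
      then show ?thesis using n[rule_format, of x] x assms(2) by linarith
    next
      case False
      then have "poly q' (- x) > 0" using n'[rule_format, of "- x"] x lc assms(2) by linarith
      then show ?thesis by (simp add: q')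
    qed
  qed
qed

text \<open>On the curve g = (g + q D) + D y^2, so nonnegativity of D and g + q D exhibits g as a
  sum of squares. What matters is that \<open>e\<close> precedes g: it comes from the certificates
  of the two generators of the cone.\<close>

lemma linear_nonneg_certificate:
  fixes q :: "real poly"
  assumes deg: "degree q = 4" "lead_coeff q = 1" and neg: "poly q s < 0"
    and simple: "\<And>x. poly q x = 0 \<Longrightarrow> poly (pderiv q) x \<noteq> 0"
  obtains e where "\<And>g. degree g \<le> 1 \<Longrightarrow> (\<And>x. poly q x \<le> 0 \<Longrightarrow> poly g x \<ge> 0) \<Longrightarrow>
    \<exists>D. (\<forall>x. poly D x \<ge> 0) \<and> degree D \<le> 2 * e \<and> (\<forall>x. poly (g + q * D) x \<ge> 0)"
proof -
  have "q \<noteq> 0" using deg by auto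
  define R where "R = {x. poly q x = 0}"
  have fin: "finite R" unfolding R_def by (rule poly_roots_finite[OF \<open>q \<noteq> 0\<close>])
  obtain M where M: "\<And>x. \<bar>x\<bar> \<ge> M \<Longrightarrow> poly q x > 0"
    using positive_outside_interval[of q] deg by auto
  \<comment> \<open>As q is positive far out on both sides, a negative value has roots to its left
    and right. So q has no negative values outside the extreme roots, and these are
    distinct.\<close>
  have left: "\<exists>y\<in>R. y < x" if x: "poly q x < 0" for x
  proof -
    define z where "z = min (x - 1) (- \<bar>M\<bar>)"
    have "z < x" "\<bar>z\<bar> \<ge> M" by (auto simp: z_def)
    then have "z < x" "poly q z > 0" using M by auto
    then obtain y where "z < y" "y < x" "poly q y = 0" using poly_IVT_neg[of z x q] x by blast
    then show ?thesis by (auto simp: R_def)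
  qed
  have right: "\<exists>y\<in>R. x < y" if x: "poly q x < 0" for x
  proof -
    define z where "z = max (x + 1) \<bar>M\<bar>"
    have "x < z" "\<bar>z\<bar> \<ge> M" by (auto simp: z_def)
    then have "x < z" "poly q z > 0" using M by auto
    then obtain y where "x < y" "y < z" "poly q y = 0" using poly_IVT_pos[of x z q] x by blast
    then show ?thesis by (auto simp: R_def)
  qed
  obtain y1 y4 where y: "y1 \<in> R" "y1 < s" "y4 \<in> R" "s < y4" using left[OF neg] right[OF neg] by blast
  define r1 r4 where "r1 = Min R" and "r4 = Max R"
  have "R \<noteq> {}" using y by auto
  then have r: "r1 \<in> R" "r4 \<in> R" using fin by (simp_all add: r1_def r4_def)
  have "r1 \<le> y1" "y4 \<le> r4" using fin y by (simp_all add: r1_def r4_def)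
  then have "r1 < r4" using y by linarith
  define L where "L = r4 - r1"
  have L: "L > 0" "r4 = r1 + L" using \<open>r1 < r4\<close> by (simp_all add: L_def)
  have q0: "poly q r1 = 0" "poly q r4 = 0" using r by (simp_all add: R_def)
  have below: "poly q x > 0" if "x < r1" for x
  proof (rule ccontr)
    assume "\<not> poly q x > 0"
    moreover have "x \<notin> R" using Min_le[OF fin, of x] that by (auto simp: r1_def)
    ultimately have "poly q x < 0" by (simp add: R_def)
    then obtain y where "y \<in> R" "y < x" using left by blast
    moreover have "r1 \<le> y" using fin \<open>y \<in> R\<close> by (simp add: r1_def)
    ultimately show False using that by linarith
  qed
  have above: "poly q x > 0" if "x > r4" for x
  proof (rule ccontr)
    assume "\<not> poly q x > 0"
    moreover have "x \<notin> R" using Max_ge[OF fin, of x] that by (auto simp: r4_def)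
    ultimately have "poly q x < 0" by (simp add: R_def)
    then obtain y where "y \<in> R" "x < y" using right by blast
    moreover have "y \<le> r4" using fin \<open>y \<in> R\<close> by (simp add: r4_def)
    ultimately show False using that by linarith
  qed
  have below': "poly q x \<ge> 0" if "x \<le> r1" for x using below[of x] q0 that by (cases "x = r1") auto
  have above': "poly q x \<ge> 0" if "x \<ge> r4" for x using above[of x] q0 that by (cases "x = r4") auto
  \<comment> \<open>The affine substitution moves r1 to 0 and r4 to -1, reversing orientation, so
    that the outside of the interval becomes z > 0 and z < -1. For \<open>q4\<close> the roles of
    the two roots are exchanged and orientation is kept.\<close>
  define q1 where "q1 = q \<circ>\<^sub>p [:r1, - L:]"
  obtain D1 where D1: "\<And>z. poly D1 z \<ge> 0" "\<And>z. - z + poly q1 z * poly D1 z \<ge> 0"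
  proof (rule linear_certificate_at_simple_root[of q1])
    show "poly q1 0 = 0" by (simp add: q1_def poly_pcompose q0)
    show "poly (pderiv q1) 0 \<noteq> 0"
      using simple[OF q0(1)] L by (simp add: q1_def pderiv_pcompose poly_pcompose pderiv_pCons)
    show "poly q1 z > 0" if "z > 0" for z
      using below[of "r1 - z * L"] L that by (simp add: q1_def poly_pcompose)
    show "poly q1 z \<ge> 0" if "z \<le> -1" for z
    proof -
      have "(- z) * L \<ge> 1 * L" using L that by (intro mult_right_mono) auto
      then show ?thesis using above'[of "r1 - z * L"] L by (simp add: q1_def poly_pcompose)
    qed
  qed blast
  define q4 where "q4 = q \<circ>\<^sub>p [:r4, L:]"
  obtain D4 where D4: "\<And>z. poly D4 z \<ge> 0" "\<And>z. - z + poly q4 z * poly D4 z \<ge> 0"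
  proof (rule linear_certificate_at_simple_root[of q4])
    show "poly q4 0 = 0" by (simp add: q4_def poly_pcompose q0)
    show "poly (pderiv q4) 0 \<noteq> 0"
      using simple[OF q0(2)] L by (simp add: q4_def pderiv_pcompose poly_pcompose pderiv_pCons)
    show "poly q4 z > 0" if "z > 0" for z
      using above[of "r4 + z * L"] L that by (simp add: q4_def poly_pcompose)
    show "poly q4 z \<ge> 0" if "z \<le> -1" for z
    proof -
      have "(- z) * L \<ge> 1 * L" using L that by (intro mult_right_mono) auto
      then show ?thesis using below'[of "r4 + z * L"] L by (simp add: q4_def poly_pcompose)
    qed
  qed blast
  define E1 where "E1 = D1 \<circ>\<^sub>p [:r1 / L, - 1 / L:]"
  define E4 where "E4 = D4 \<circ>\<^sub>p [:- r4 / L, 1 / L:]"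
  have E0: "poly E1 x \<ge> 0" "poly E4 x \<ge> 0" for x
    unfolding E1_def E4_def poly_pcompose by (rule D1 D4)+
  have E1: "(x - r1) / L + poly q x * poly E1 x \<ge> 0" for x
  proof -
    have z: "poly [:r1 / L, - 1 / L:] x = - ((x - r1) / L)" by (simp add: diff_divide_distrib)
    have "r1 + - ((x - r1) / L) * (- L) = x" using L by simp
    then have "poly q1 (- ((x - r1) / L)) = poly q x" unfolding q1_def pcompose_line by (simp only:)
    moreover have "poly E1 x = poly D1 (- ((x - r1) / L))" unfolding E1_def poly_pcompose z ..
    ultimately show ?thesis using D1(2)[of "- ((x - r1) / L)"] by simp
  qed
  have E4: "(r4 - x) / L + poly q x * poly E4 x \<ge> 0" for x
  proof -
    have z: "poly [:- r4 / L, 1 / L:] x = - ((r4 - x) / L)" by (simp add: diff_divide_distrib)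
    have "r4 + - ((r4 - x) / L) * L = x" using L by simp
    then have "poly q4 (- ((r4 - x) / L)) = poly q x" unfolding q4_def pcompose_line by (simp only:)
    moreover have "poly E4 x = poly D4 (- ((r4 - x) / L))" unfolding E4_def poly_pcompose z ..
    ultimately show ?thesis using D4(2)[of "- ((r4 - x) / L)"] by simp
  qed
  show thesis
  proof (rule that[of "degree E1 + degree E4"])
    fix g assume dg: "degree g \<le> 1" and gK: "\<And>x. poly q x \<le> 0 \<Longrightarrow> poly g x \<ge> 0"
    \<comment> \<open>Both values are nonnegative because q vanishes at r1 and r4. They are the
      weights of g as an interpolant between these roots.\<close>
    define u v where "u = poly g r1" and "v = poly g r4"
    have uv: "u \<ge> 0" "v \<ge> 0" using gK q0 by (simp_all add: u_def v_def)
    have gx: "poly g x = v * ((x - r1) / L) + u * ((r4 - x) / L)" for x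
    proof -
      have g01: "poly g x = coeff g 0 + coeff g 1 * x" for x using poly_altdef_le[OF dg, of x] by simp
      have "L * poly g x = v * (x - r1) + u * (r4 - x)"
        unfolding u_def v_def g01 L(2) by (simp add: algebra_simps)
      moreover have "v * ((x - r1) / L) + u * ((r4 - x) / L) = (v * (x - r1) + u * (r4 - x)) / L"
        by (simp add: add_divide_distrib)
      ultimately show ?thesis using L(1) by (metis less_irrefl nonzero_mult_div_cancel_left)
    qed
    define D where "D = smult v E1 + smult u E4"
    have "poly D x \<ge> 0" for x using E0[of x] uv by (simp add: D_def)
    moreover have "degree D \<le> 2 * (degree E1 + degree E4)"
      unfolding D_def using degree_smult_le[of v E1] degree_smult_le[of u E4] by (intro degree_add_le) auto
    moreover have "poly (g + q * D) x \<ge> 0" for x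
    proof -
      have "poly (g + q * D) x = v * ((x - r1) / L + poly q x * poly E1 x) + u * ((r4 - x) / L + poly q x * poly E4 x)"
        unfolding poly_add poly_mult gx D_def poly_smult by (simp only: algebra_simps)
      then show ?thesis using mult_nonneg_nonneg[OF uv(2) E1[of x]] mult_nonneg_nonneg[OF uv(1) E4[of x]] by linarith
    qed
    ultimately show "\<exists>D. (\<forall>x. poly D x \<ge> 0) \<and> degree D \<le> 2 * (degree E1 + degree E4) \<and> (\<forall>x. poly (g + q * D) x \<ge> 0)"
      by blast
  qed
qed

text \<open>A polynomial of degree one changes sign at its root, which is impossible where q is
  negative on both sides. Thus the points of the curve over the root have imaginary or zero
  y.\<close>

lemma linear_nonneg_root:
  fixes q g :: "real poly"
  assumes gK: "\<And>x. poly q x \<le> 0 \<Longrightarrow> poly g x \<ge> 0"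
    and dg: "degree g = 1" and root: "poly g x0 = 0"
  shows "poly q x0 \<ge> 0"
proof (rule ccontr)
  assume "\<not> poly q x0 \<ge> 0"
  then have "poly q x0 < 0" by simp
  have g01: "poly g x = coeff g 0 + coeff g 1 * x" for x using poly_altdef_le[of g 1 x] dg by simp
  have "coeff g 1 \<noteq> 0" using dg by (metis degree_0 leading_coeff_0_iff zero_neq_one)
  have gx: "poly g x = coeff g 1 * (x - x0)" for x
    using root g01[of x] g01[of x0] by (simp add: right_diff_distrib)
  have "(poly q \<longlongrightarrow> poly q x0) (at x0)"
    by (rule isContD[unfolded isCont_def]) (simp add: isCont_def[symmetric])
  then have ev: "eventually (\<lambda>x. poly q x < 0) (at x0)"
    using \<open>poly q x0 < 0\<close> order_tendstoD(2) by blast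
  have "eventually (\<lambda>x. poly q x < 0) (at_right x0)" "eventually (\<lambda>x. poly q x < 0) (at_left x0)"
    using ev by (simp_all add: eventually_at_split)
  then obtain u v where u: "u > x0" "\<And>x. x0 < x \<Longrightarrow> x < u \<Longrightarrow> poly q x < 0"
    and v: "v < x0" "\<And>x. v < x \<Longrightarrow> x < x0 \<Longrightarrow> poly q x < 0"
    unfolding eventually_at_right_field eventually_at_left_field by blast
  have "poly g ((x0 + u) / 2) \<ge> 0" using u by (intro gK less_imp_le u(2)) auto
  then have "coeff g 1 * ((x0 + u) / 2 - x0) \<ge> 0" by (simp only: gx)
  moreover have "poly g ((v + x0) / 2) \<ge> 0" using v by (intro gK less_imp_le v(2)) auto
  then have "coeff g 1 * ((v + x0) / 2 - x0) \<ge> 0" by (simp only: gx)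
  moreover have "(x0 + u) / 2 - x0 > 0" "(v + x0) / 2 - x0 < 0" using u(1) v(1) by auto
  ultimately show False using \<open>coeff g 1 \<noteq> 0\<close> by (simp add: zero_le_mult_iff)
qed

lemma curve_sos_of_positive:
  fixes q a b :: "real poly"
  assumes q: "degree q = 4" "lead_coeff q = 1" and neg: "poly q s < 0"
    and cert: "\<And>g. degree g \<le> 1 \<Longrightarrow> (\<And>x. poly q x \<le> 0 \<Longrightarrow> poly g x \<ge> 0) \<Longrightarrow>
      \<exists>D. (\<forall>x. poly D x \<ge> 0) \<and> degree D \<le> 2 * e \<and> (\<forall>x. poly (g + q * D) x \<ge> 0)"
    and k: "k \<ge> 2" and da: "degree a = 2 * k - 1" and db: "degree b \<le> 2 * k - 3"
    and pos: "\<And>x y. y\<^sup>2 + poly q x = 0 \<Longrightarrow> poly a x + poly b x * y > 0"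
    and coprime: "\<And>z. poly (cpoly a) z = 0 \<Longrightarrow> poly (cpoly b) z \<noteq> 0"
  shows "curve_sos q 6 (k + e + 2) a b"
proof -
  obtain \<alpha> \<beta> g where nz: "\<alpha> \<noteq> 0 \<or> \<beta> \<noteq> 0" and d\<alpha>: "degree \<alpha> \<le> k" and d\<beta>: "degree \<beta> \<le> k - 2"
    and dg: "degree g \<le> 1"
    and X: "\<And>x. poly a x * poly g x =
       (cmod (poly \<alpha> (of_real x)))\<^sup>2 - poly q x * (cmod (poly \<beta> (of_real x)))\<^sup>2"
    and Y: "\<And>x. poly b x * poly g x = 2 * Re (poly \<alpha> (of_real x) * cnj (poly \<beta> (of_real x)))"
    using linear_multiple_is_hermitian_square[OF q k da db pos coprime] by blast
  \<comment> \<open>If g = 0, the Hermitian square of h vanishes. Where q < 0 it contains two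
    nonnegative terms, so \<alpha> and \<beta> would vanish at infinitely many points.\<close>
  have g0: "g \<noteq> 0"
  proof
    assume "g = 0"
    have "poly \<alpha> (of_real x) = 0 \<and> poly \<beta> (of_real x) = 0" if "poly q x < 0" for x
    proof -
      have "(cmod (poly \<alpha> (of_real x)))\<^sup>2 + (- poly q x) * (cmod (poly \<beta> (of_real x)))\<^sup>2 = 0"
        using X[of x] \<open>g = 0\<close> by simp
      moreover have "(cmod (poly \<alpha> (of_real x)))\<^sup>2 \<ge> 0" "(- poly q x) * (cmod (poly \<beta> (of_real x)))\<^sup>2 \<ge> 0"
        using that by (simp, intro mult_nonneg_nonneg) auto
      ultimately have "(cmod (poly \<alpha> (of_real x)))\<^sup>2 = 0" "(- poly q x) * (cmod (poly \<beta> (of_real x)))\<^sup>2 = 0"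
        by linarith+
      then show ?thesis using that by simp
    qed
    then have "of_real ` {x. poly q x < 0} \<subseteq> {z. poly \<alpha> z = poly 0 z}"
      "of_real ` {x. poly q x < 0} \<subseteq> {z. poly \<beta> z = poly 0 z}" by auto
    moreover have "infinite (complex_of_real ` {x. poly q x < 0})"
      using infinite_negative_set[OF neg] by (simp add: finite_image_iff inj_on_def)
    ultimately have "\<alpha> = 0" "\<beta> = 0"
      using poly_eq_from_infinite[of \<alpha> 0] poly_eq_from_infinite[of \<beta> 0] infinite_super by blast+
    with nz show False by simp
  qed
  \<comment> \<open>At a real point f g is the squared modulus of h, while f is strictly positive
    there.\<close>
  have gK: "poly g x \<ge> 0" if "poly q x \<le> 0" for x
  proof -
    define y where "y = sqrt (- poly q x)"
    have y: "y\<^sup>2 = - poly q x" using that by (simp add: y_def)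
    define \<alpha>x \<beta>x where "\<alpha>x = poly \<alpha> (of_real x)" and "\<beta>x = poly \<beta> (of_real x)"
    have "(poly a x + poly b x * y) * poly g x = poly a x * poly g x + y * (poly b x * poly g x)"
      by (simp add: algebra_simps)
    also have "\<dots> = (cmod \<alpha>x)\<^sup>2 + y\<^sup>2 * (cmod \<beta>x)\<^sup>2 + y * (2 * Re (\<alpha>x * cnj \<beta>x))"
      unfolding X Y y \<alpha>x_def \<beta>x_def by simp
    also have "\<dots> = (cmod (\<alpha>x + y * \<beta>x))\<^sup>2"
      unfolding cmod_power2 by (simp add: power2_eq_square algebra_simps)
    finally have "(poly a x + poly b x * y) * poly g x \<ge> 0" by simp
    moreover have "poly a x + poly b x * y > 0" using y by (intro pos) simp
    ultimately show ?thesis by (simp add: zero_le_mult_iff)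
  qed
  obtain D where D: "\<And>x. poly D x \<ge> 0" "degree D \<le> 2 * e" "\<And>x. poly (g + q * D) x \<ge> 0"
    using cert[OF dg gK] by blast
  show ?thesis
    by (rule curve_sos_of_linear_multiple[OF q(1) neg k d\<alpha> d\<beta> g0 dg X Y D])
      (rule linear_nonneg_root[OF gK])
qed

section \<open>Perturbation\<close>

lemma generic_perturbation:
  fixes F :: "complex set"
  assumes "finite F"
  obtains \<delta> :: real where "\<delta> > 0" "\<And>\<epsilon>. 0 < \<epsilon> \<Longrightarrow> \<epsilon> \<le> \<delta> \<Longrightarrow> of_real \<epsilon> \<notin> F"
proof -
  define G where "G = Re ` F \<inter> {0<..}"
  have fin: "finite (insert 1 G)" using assms by (simp add: G_def)
  define \<delta> where "\<delta> = Min (insert 1 G) / 2"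
  have "Min (insert 1 G) \<in> insert 1 G" using fin by (intro Min_in) auto
  then have "\<delta> > 0" by (auto simp: \<delta>_def G_def)
  moreover have "of_real \<epsilon> \<notin> F" if e: "0 < \<epsilon>" "\<epsilon> \<le> \<delta>" for \<epsilon>
  proof
    assume "of_real \<epsilon> \<in> F"
    then have "Re (of_real \<epsilon>) \<in> Re ` F" by (rule imageI)
    then have "\<epsilon> \<in> insert 1 G" using e by (simp add: G_def)
    then have "2 * \<delta> \<le> \<epsilon>" using Min_le[OF fin] by (simp add: \<delta>_def)
    then show False using e \<open>\<delta> > 0\<close> by linarith
  qed
  ultimately show thesis using that by blast
qed

text \<open>
  Adding $\epsilon (x^n + C)$ makes $f$ strictly positive on $C(\mathbb{R})$, gives it the exact odd
  degree $n$, and removes the common roots of its two components.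
\<close>

lemma curve_sos_of_psd_aux:
  fixes q a b :: "real poly"
  assumes q: "degree q = 4" "lead_coeff q = 1" and neg: "poly q s < 0"
    and cert: "\<And>g. degree g \<le> 1 \<Longrightarrow> (\<And>x. poly q x \<le> 0 \<Longrightarrow> poly g x \<ge> 0) \<Longrightarrow>
      \<exists>D. (\<forall>x. poly D x \<ge> 0) \<and> degree D \<le> 2 * e \<and> (\<forall>x. poly (g + q * D) x \<ge> 0)"
    and k: "k \<ge> 2" and da: "degree a \<le> 2 * k - 1" and db: "degree b \<le> 2 * k - 3" and b: "b \<noteq> 0"
    and psd: "\<And>x y. y\<^sup>2 + poly q x = 0 \<Longrightarrow> poly a x + poly b x * y \<ge> 0"
  shows "curve_sos q 6 (k + e + 2) a b"
proof -
  define n where "n = 2 * k - 1"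
  have "n > 0" using k by (simp add: n_def)
  define Z where "Z = {z. poly (cpoly b) z = 0}"
  have "cpoly b \<noteq> 0" using b by (metis cpoly_dvd_cpoly_iff dvd_0_left_iff map_poly_0)
  then have "finite Z" unfolding Z_def by (rule poly_roots_finite)
  obtain M where M: "\<And>x. \<bar>x\<bar> \<ge> M \<Longrightarrow> poly q x > 0"
    using positive_outside_interval[of q] q by auto
  \<comment> \<open>C is large because n is odd and x^n may be negative on the bounded set q \<le>
    0. Avoiding -z^n keeps x^n + C nonzero at the roots z of b, so each of these roots excludes only
    one \<epsilon>.\<close>
  obtain C where C: "C \<ge> \<bar>M\<bar> ^ n + 1" "of_real C \<notin> (\<lambda>z. - (z ^ n)) ` Z"
  proof -
    have "infinite (complex_of_real ` {\<bar>M\<bar> ^ n + 1..})"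
      by (simp add: finite_image_iff inj_on_def infinite_Ici)
    moreover have "finite ((\<lambda>z. - (z ^ n)) ` Z)" using \<open>finite Z\<close> by (rule finite_imageI)
    ultimately have "\<not> complex_of_real ` {\<bar>M\<bar> ^ n + 1..} \<subseteq> (\<lambda>z. - (z ^ n)) ` Z"
      using finite_subset by blast
    then show thesis using that by auto
  qed
  define p where "p = monom 1 n + [:C:]"
  have px: "poly p x = x ^ n + C" for x by (simp add: p_def poly_monom)
  have cpz: "poly (cpoly p) z = z ^ n + of_real C" for z
    by (simp add: p_def cpoly_add map_poly_monom poly_monom map_poly_pCons)
  have ppos: "poly p x > 0" if "poly q x \<le> 0" for x
  proof -
    have "\<bar>x\<bar> \<le> \<bar>M\<bar>" using M[of x] that by linarith
    then have "\<bar>x\<bar> ^ n \<le> \<bar>M\<bar> ^ n" by (intro power_mono) auto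
    then have "\<bar>x ^ n\<bar> \<le> \<bar>M\<bar> ^ n" by (simp add: power_abs)
    then show ?thesis using C(1) unfolding px by linarith
  qed
  \<comment> \<open>The excluded parameters: one that would cancel the coefficient of x^n, and for
    each root of b the one that would make it a common root.\<close>
  define F where "F = insert (- complex_of_real (coeff a n)) ((\<lambda>z. - poly (cpoly a) z / poly (cpoly p) z) ` Z)"
  have "finite F" using \<open>finite Z\<close> by (simp add: F_def)
  then obtain \<delta> where \<delta>: "\<delta> > 0" "\<And>\<epsilon>. 0 < \<epsilon> \<Longrightarrow> \<epsilon> \<le> \<delta> \<Longrightarrow> of_real \<epsilon> \<notin> F"
    using generic_perturbation[of F] by blast
  define \<epsilon> where "\<epsilon> j = \<delta> * inverse (real (Suc j))" for j
  have \<epsilon>: "\<epsilon> j > 0" "of_real (\<epsilon> j) \<notin> F" for j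
  proof -
    show "\<epsilon> j > 0" using \<delta>(1) by (simp add: \<epsilon>_def)
    moreover have "\<epsilon> j \<le> \<delta> * 1" unfolding \<epsilon>_def using \<delta>(1)
      by (intro mult_left_mono) (auto simp: inverse_le_1_iff)
    ultimately show "of_real (\<epsilon> j) \<notin> F" by (intro \<delta>(2)) auto
  qed
  have lim: "\<epsilon> \<longlonglongrightarrow> 0"
    unfolding \<epsilon>_def using LIMSEQ_inverse_real_of_nat by (rule tendsto_mult_right_zero)
  have dp: "degree p \<le> n" unfolding p_def by (intro degree_add_le degree_monom_le) simp
  have cp: "coeff p n = 1" using \<open>n > 0\<close> by (cases n) (simp_all add: p_def)
  show ?thesis
  proof (rule curve_sos_closed[OF neg])
    fix j
    show "curve_sos q 6 (k + e + 2) (a + smult (\<epsilon> j) p) b"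
    proof (rule curve_sos_of_positive[OF q neg cert k _ db])
      have "coeff (a + smult (\<epsilon> j) p) n \<noteq> 0"
      proof
        assume "coeff (a + smult (\<epsilon> j) p) n = 0"
        then have "\<epsilon> j = - coeff a n" by (simp add: cp)
        then show False using \<epsilon>(2)[of j] by (simp add: F_def)
      qed
      then have "n \<le> degree (a + smult (\<epsilon> j) p)" by (rule le_degree)
      moreover have "degree (a + smult (\<epsilon> j) p) \<le> n"
        using da dp degree_smult_le[of "\<epsilon> j" p] by (intro degree_add_le) (auto simp: n_def)
      ultimately show "degree (a + smult (\<epsilon> j) p) = 2 * k - 1" by (simp add: n_def)
    next
      fix x y :: real
      assume y: "y\<^sup>2 + poly q x = 0"
      then have "poly q x \<le> 0" by (metis add_le_same_cancel1 zero_le_power2 add.commute)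
      then have "\<epsilon> j * poly p x > 0" using \<epsilon>(1) ppos by simp
      then show "poly (a + smult (\<epsilon> j) p) x + poly b x * y > 0" using psd[OF y] by simp
    next
      fix z
      assume z: "poly (cpoly (a + smult (\<epsilon> j) p)) z = 0"
      show "poly (cpoly b) z \<noteq> 0"
      proof
        assume "poly (cpoly b) z = 0"
        then have "z \<in> Z" by (simp add: Z_def)
        have "poly (cpoly p) z \<noteq> 0"
        proof
          assume "poly (cpoly p) z = 0"
          then have "of_real C = - (z ^ n)" by (simp add: cpz add_eq_0_iff)
          then show False using C(2) \<open>z \<in> Z\<close> by blast
        qed
        moreover have "poly (cpoly a) z + of_real (\<epsilon> j) * poly (cpoly p) z = 0"
          using z by (simp add: cpoly_add cpoly_smult)
        ultimately have "of_real (\<epsilon> j) = - poly (cpoly a) z / poly (cpoly p) z"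
          by (simp add: field_simps add_eq_0_iff)
        then show False using \<epsilon>(2)[of j] \<open>z \<in> Z\<close> by (auto simp: F_def)
      qed
    qed
  next
    fix x
    have "(\<lambda>j. poly a x + \<epsilon> j * poly p x) \<longlonglongrightarrow> poly a x + 0 * poly p x"
      by (intro tendsto_intros lim)
    then show "(\<lambda>j. poly (a + smult (\<epsilon> j) p) x) \<longlonglongrightarrow> poly a x" by simp
  qed simp
qed

text \<open>For b = 0 every root of a would be a common root, so a nonzero y component is created
  first, by adding \<epsilon> (1 + y)^2 = \<epsilon> (1 - q + 2 y), a square on the curve. Its
  quartic part fits below 2k - 1 because k \<ge> 3. A second limit removes it.\<close>

lemma curve_sos_of_psd:
  fixes q a b :: "real poly"
  assumes q: "degree q = 4" "lead_coeff q = 1" and neg: "poly q s < 0"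
    and cert: "\<And>g. degree g \<le> 1 \<Longrightarrow> (\<And>x. poly q x \<le> 0 \<Longrightarrow> poly g x \<ge> 0) \<Longrightarrow>
      \<exists>D. (\<forall>x. poly D x \<ge> 0) \<and> degree D \<le> 2 * e \<and> (\<forall>x. poly (g + q * D) x \<ge> 0)"
    and k: "k \<ge> 3" and da: "degree a \<le> 2 * k - 1" and db: "degree b \<le> 2 * k - 3"
    and psd: "\<And>x y. y\<^sup>2 + poly q x = 0 \<Longrightarrow> poly a x + poly b x * y \<ge> 0"
  shows "curve_sos q 6 (k + e + 2) a b"
proof (cases "b = 0")
  case False
  then show ?thesis using curve_sos_of_psd_aux[OF q neg cert _ da db _ psd] k by simp
next
  case True
  define \<epsilon> where "\<epsilon> j = inverse (real (Suc j))" for j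
  have \<epsilon>: "\<epsilon> j > 0" for j by (simp add: \<epsilon>_def)
  have lim: "\<epsilon> \<longlonglongrightarrow> 0" unfolding \<epsilon>_def by (rule LIMSEQ_inverse_real_of_nat)
  show ?thesis
  proof (rule curve_sos_closed[OF neg])
    fix j
    show "curve_sos q 6 (k + e + 2) (a + smult (\<epsilon> j) (1 - q)) [:2 * \<epsilon> j:]"
    proof (rule curve_sos_of_psd_aux[OF q neg cert])
      show "degree (a + smult (\<epsilon> j) (1 - q)) \<le> 2 * k - 1"
        using da k q(1) degree_smult_le[of "\<epsilon> j" "1 - q"] degree_diff_le_max[of 1 q]
        by (intro degree_add_le) auto
      show "[:2 * \<epsilon> j:] \<noteq> 0" using \<epsilon>[of j] by simp
    next
      fix x y :: real
      assume y: "y\<^sup>2 + poly q x = 0"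
      have "poly (a + smult (\<epsilon> j) (1 - q)) x + poly [:2 * \<epsilon> j:] x * y
        = (poly a x + poly b x * y) + \<epsilon> j * (1 + y)\<^sup>2"
        using True y by (simp add: power2_sum eq_neg_iff_add_eq_0[symmetric] algebra_simps)
      also have "\<dots> \<ge> 0" using psd[OF y] \<epsilon>[of j] by simp
      finally show "poly (a + smult (\<epsilon> j) (1 - q)) x + poly [:2 * \<epsilon> j:] x * y \<ge> 0" .
    qed (use k in auto)
  next
    fix x
    have "(\<lambda>j. poly a x + \<epsilon> j * (1 - poly q x)) \<longlonglongrightarrow> poly a x + 0 * (1 - poly q x)"
      by (intro tendsto_intros lim)
    then show "(\<lambda>j. poly (a + smult (\<epsilon> j) (1 - q)) x) \<longlonglongrightarrow> poly a x" by simp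
    have "(\<lambda>j. 2 * \<epsilon> j) \<longlonglongrightarrow> 2 * 0" by (intro tendsto_intros lim)
    then show "(\<lambda>j. poly [:2 * \<epsilon> j:] x) \<longlonglongrightarrow> poly b x" using True by simp
  qed
qed

section \<open>The bound for theta\<close>

lemma theta_le_of_curve_sos:
  assumes "curve_sos q r d (fst f) (snd f)" and "d \<ge> 2"
  shows "theta q f \<le> enat d"
proof -
  obtain c e :: "nat \<Rightarrow> real poly" where ce: "\<And>i. i < r \<Longrightarrow> degree (c i) \<le> d" "\<And>i. i < r \<Longrightarrow> degree (e i) \<le> d - 2"
    "fst f = (\<Sum>i<r. (c i)\<^sup>2 - q * (e i)\<^sup>2)" "snd f = (\<Sum>i<r. 2 * c i * e i)"
    using assms(1) unfolding curve_sos_def by blast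
  define gs where "gs = map (\<lambda>i. (c i, e i)) [0..<r]"
  have "f = csum_sq q gs"
    by (rule prod_eqI)
      (simp_all add: ce(3,4) csum_sq_def csq_def gs_def o_def interv_sum_list_conv_sum_set_nat atLeast0LessThan)
  moreover have "delta g \<le> ereal (real d)" if g: "g \<in> set gs" for g
  proof -
    obtain i where i: "i < r" "g = (c i, e i)" using g by (auto simp: gs_def)
    have "real (degree (e i)) + 2 \<le> real d" using ce(2)[OF i(1)] assms(2) by linarith
    then show ?thesis using ce(1)[OF i(1)] by (auto simp: delta_def deg_m_def i(2))
  qed
  ultimately have "sos_deg q f d" unfolding sos_deg_def by blast
  then show ?thesis unfolding theta_def by (auto intro: Least_le)
qed

theorem theorem2p13:
  fixes q :: "real poly"
  assumes "degree q = 4" and "lead_coeff q = 1"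
    and "\<exists>x. poly q x > 0" and "\<exists>x. poly q x < 0"
    and "rsquarefree (map_poly complex_of_real q)"
  shows "\<exists>N::nat. N \<ge> 1 \<and>
           (\<forall>f::crv. f \<noteq> (0, 0) \<longrightarrow> psd_on_curve q f \<longrightarrow>
              theta q f \<le> enat (N + nat \<lceil>real_of_ereal (delta f) / 2\<rceil>))"
proof -
  obtain s where neg: "poly q s < 0" using assms(4) by blast
  have "pderiv (cpoly q) = cpoly (pderiv q)"
    by (rule poly_eqI) (simp add: coeff_pderiv coeff_map_poly)
  then have simple: "poly (pderiv q) x \<noteq> 0" if "poly q x = 0" for x
    using assms(5) that unfolding rsquarefree_roots by (metis of_real_0 poly_cpoly_of_real)
  obtain e where cert: "\<And>g. degree g \<le> 1 \<Longrightarrow> (\<And>x. poly q x \<le> 0 \<Longrightarrow> poly g x \<ge> 0) \<Longrightarrow>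
    \<exists>D. (\<forall>x. poly D x \<ge> 0) \<and> degree D \<le> 2 * e \<and> (\<forall>x. poly (g + q * D) x \<ge> 0)"
    using linear_nonneg_certificate[OF assms(1,2) neg simple] by blast
  have "theta q f \<le> enat (e + 5 + nat \<lceil>real_of_ereal (delta f) / 2\<rceil>)"
    if f: "f \<noteq> (0, 0)" "psd_on_curve q f" for f
  proof -
    define m where "m = nat \<lceil>real_of_ereal (delta f) / 2\<rceil>"
    \<comment> \<open>For nonzero f the value is finite, so \<open>real_of_ereal\<close> does not
      fall back on its default 0.\<close>
    have "delta f \<noteq> \<infinity>" "delta f \<noteq> - \<infinity>"
      using f(1) by (auto simp: delta_def deg_m_def max_def prod_eq_iff)
    then have \<delta>: "delta f = ereal (real_of_ereal (delta f))" by (cases "delta f") auto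
    have m: "real_of_ereal (delta f) \<le> 2 * real m" unfolding m_def by linarith
    have "deg_m (fst f) \<le> ereal (2 * real m)" "deg_m (snd f) + 2 \<le> ereal (2 * real m)"
      using m \<delta> unfolding delta_def
      by (metis ereal_less_eq(3) max.bounded_iff order.trans max.cobounded1 max.cobounded2)+
    \<comment> \<open>Taking k = m + 3 guarantees k \<ge> 3 even for m = 0. The resulting degree m +
      3 + e + 2 is the origin of N = e + 5.\<close>
    then have "degree (fst f) \<le> 2 * (m + 3) - 1" "degree (snd f) \<le> 2 * (m + 3) - 3"
      by (auto simp: deg_m_def split: if_splits)
    moreover have "poly (fst f) x + poly (snd f) x * y \<ge> 0" if "y\<^sup>2 + poly q x = 0" for x y
      using f(2) that unfolding psd_on_curve_def by blast
    ultimately have "curve_sos q 6 (m + 3 + e + 2) (fst f) (snd f)"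
      by (intro curve_sos_of_psd[OF assms(1,2) neg cert]) auto
    then have "theta q f \<le> enat (m + 3 + e + 2)" by (rule theta_le_of_curve_sos) simp
    then show ?thesis by (simp add: m_def[symmetric] add_ac)
  qed
  then show ?thesis by (intro exI[of _ "e + 5"]) simp
qed

end
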